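(* Let $n$ be an integer with $n\geq 5$. Then the following three assertions hold. (i) The largest number in $\mathrm{NS}(n)$ is $2^n=32\cdot 2^{n-5}$. Furthermore, an $n$-element lattice $L$ has exactly $2^n$ subuniverses if and only if $L$ is a chain. (ii) The second largest number in $\mathrm{NS}(n)$ is $26\cdot 2^{n-5}$. Furthermore, an $n$-element lattice $L$ has exactly $26\cdot 2^{n-5}$ subuniverses if and only if $L\cong C_1 +_{\mathrm{glu}} B_4 +_{\mathrm{glu}} C_2$ for some chains $C_1$ and $C_2$. (iii) The third largest number in $\mathrm{NS}(n)$ is $23\cdot 2^{n-5}$. Furthermore, an $n$-element lattice $L$ has exactly $23\cdot 2^{n-5}$ subuniverses if and only if $L\cong C_0 +_{\mathrm{glu}} N_5 +_{\mathrm{glu}} C_1$ for some chains $C_0$ and $C_1$.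
   Context: All lattices (in particular all chains) are finite and nonempty. A subuniverse of a lattice $L$ is a subset $X\subseteq L$ closed under the binary join and meet of $L$; the empty set is a subuniverse. $\mathrm{Sub}(L)$ denotes the set of all subuniverses of $L$. For a positive integer $n$, $\mathrm{NS}(n):=\{|\mathrm{Sub}(L)| : L \text{ is a lattice with } |L|=n\}$. For finite lattices $K$ and $L$, the glued sum $K +_{\mathrm{glu}} L$ is the ordinal sum of the posets $K\setminus\{1_K\}$, a singleton, and $L\setminus\{0_L\}$, in this order; that is, $L$ is put on top of $K$ and the elements $1_K$ and $0_L$ are identified. This operation is associative. A chain may have only one element, in which case gluing it changes nothing up to isomorphism. $B_4$ is the four-element Boolean lattice $\{0,a,b,1\}$ with $a,b$ incomparable. $N_5$ is the pentagon: the five-element lattice $\{0,a,b,c,1\}$ with $0<a<c<1$, $0<b<1$, and $b$ incomparable with both $a$ and $c$. *)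

theory Defs
  imports "HOL-Algebra.Lattice"
begin

definition finite_lattice :: "'a gorder \<Rightarrow> bool" where
  "finite_lattice L \<longleftrightarrow> lattice L \<and> finite (carrier L) \<and> carrier L \<noteq> {}"

definition finite_chain :: "'a gorder \<Rightarrow> bool" where
  "finite_chain C \<longleftrightarrow> total_order C \<and> finite (carrier C) \<and> carrier C \<noteq> {}"

definition subuniverse :: "'a gorder \<Rightarrow> 'a set \<Rightarrow> bool" where
  "subuniverse L X \<longleftrightarrow>
     X \<subseteq> carrier L \<and> (\<forall>x\<in>X. \<forall>y\<in>X. x \<squnion>\<^bsub>L\<^esub> y \<in> X \<and> x \<sqinter>\<^bsub>L\<^esub> y \<in> X)"

definition Sub :: "'a gorder \<Rightarrow> 'a set set" where
  "Sub L = {X. subuniverse L X}"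

definition lattice_iso :: "'a gorder \<Rightarrow> 'b gorder \<Rightarrow> bool" where
  "lattice_iso K L \<longleftrightarrow>
     (\<exists>f. bij_betw f (carrier K) (carrier L) \<and> join_pres K L f \<and> meet_pres K L f)"

text \<open>
  The lattices in \<open>NS n\<close> are taken on sets of natural numbers, since a set cannot collect
  structures over all types. As every finite lattice has an isomorphic copy on such a set, this
  is no restriction; see \<open>card_Sub_in_NS\<close> below.
\<close>

definition NS :: "nat \<Rightarrow> nat set" where
  "NS n = {card (Sub L) |L :: nat gorder. finite_lattice L \<and> card (carrier L) = n}"

definition kth_largest :: "nat \<Rightarrow> nat set \<Rightarrow> nat \<Rightarrow> bool" where
  "kth_largest k A x \<longleftrightarrow>
     x \<in> A \<and> finite {y \<in> A. x < y} \<and> card {y \<in> A. x < y} + 1 = k"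

definition subposet :: "'a gorder \<Rightarrow> 'a set \<Rightarrow> 'a gorder" where
  "subposet P X = P\<lparr>carrier := X\<rparr>"

definition singleton_poset :: "unit gorder" where
  "singleton_poset = \<lparr>carrier = UNIV, eq = (=), le = (=)\<rparr>"

definition ordinal_sum :: "'a gorder \<Rightarrow> 'b gorder \<Rightarrow> ('a + 'b) gorder" where
  "ordinal_sum P Q =
     \<lparr>carrier = carrier P <+> carrier Q,
      eq = (=),
      le = (\<lambda>x y. case (x, y) of
              (Inl a, Inl b) \<Rightarrow> a \<sqsubseteq>\<^bsub>P\<^esub> b
            | (Inl a, Inr b) \<Rightarrow> True
            | (Inr a, Inl b) \<Rightarrow> False
            | (Inr a, Inr b) \<Rightarrow> a \<sqsubseteq>\<^bsub>Q\<^esub> b)\<rparr>"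

definition glued_sum :: "'a gorder \<Rightarrow> 'b gorder \<Rightarrow> (('a + unit) + 'b) gorder"
    (infixl \<open>+\<^sub>g\<^sub>l\<^sub>u\<close> 65) where
  "K +\<^sub>g\<^sub>l\<^sub>u L =
     ordinal_sum
       (ordinal_sum (subposet K (carrier K - {\<top>\<^bsub>K\<^esub>})) singleton_poset)
       (subposet L (carrier L - {\<bottom>\<^bsub>L\<^esub>}))"

datatype b4 = B4_0 | B4_a | B4_b | B4_1

definition B4 :: "b4 gorder" where
  "B4 = \<lparr>carrier = UNIV, eq = (=), le = (\<lambda>x y. x = y \<or> x = B4_0 \<or> y = B4_1)\<rparr>"

datatype n5 = N5_0 | N5_a | N5_b | N5_c | N5_1

definition N5 :: "n5 gorder" where
  "N5 = \<lparr>carrier = UNIV, eq = (=),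
         le = (\<lambda>x y. x = y \<or> x = N5_0 \<or> y = N5_1 \<or> (x = N5_a \<and> y = N5_c))\<rparr>"

lemma card_Sub_lattice_iso:
  assumes "lattice_iso K L"
  shows "card (Sub K) = card (Sub L)"
proof -
  obtain f where f: "bij_betw f (carrier K) (carrier L)"
    and K: "lattice K"
    and j: "\<And>x y. x \<in> carrier K \<Longrightarrow> y \<in> carrier K \<Longrightarrow> f (x \<squnion>\<^bsub>K\<^esub> y) = f x \<squnion>\<^bsub>L\<^esub> f y"
    and m: "\<And>x y. x \<in> carrier K \<Longrightarrow> y \<in> carrier K \<Longrightarrow> f (x \<sqinter>\<^bsub>K\<^esub> y) = f x \<sqinter>\<^bsub>L\<^esub> f y"
    using assms unfolding lattice_iso_def join_pres_def meet_pres_def by blast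
  interpret K: lattice K by (rule K)
  have inj: "inj_on f (carrier K)" and im: "f ` carrier K = carrier L"
    using f by (auto simp: bij_betw_def)
  have iff: "subuniverse L (f ` X) \<longleftrightarrow> subuniverse K X" if X: "X \<subseteq> carrier K" for X
  proof -
    have mem: "f z \<in> f ` X \<longleftrightarrow> z \<in> X" if "z \<in> carrier K" for z
      using inj_on_image_mem_iff[OF inj that X] .
    have "(f x \<squnion>\<^bsub>L\<^esub> f y \<in> f ` X \<and> f x \<sqinter>\<^bsub>L\<^esub> f y \<in> f ` X) \<longleftrightarrow>
        (x \<squnion>\<^bsub>K\<^esub> y \<in> X \<and> x \<sqinter>\<^bsub>K\<^esub> y \<in> X)" if "x \<in> X" "y \<in> X" for x y
    proof -
      have c: "x \<in> carrier K" "y \<in> carrier K" using that X by auto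
      show ?thesis
        using mem[OF K.join_closed[OF c]] mem[OF K.meet_closed[OF c]] j[OF c] m[OF c] by simp
    qed
    moreover have "f ` X \<subseteq> carrier L" using X im by blast
    ultimately show ?thesis unfolding subuniverse_def using X by simp
  qed
  have "Sub L = (`) f ` Sub K"
  proof (intro Set.set_eqI iffI)
    fix Y assume Y: "Y \<in> Sub L"
    then have "Y \<subseteq> f ` carrier K" by (simp add: Sub_def subuniverse_def im)
    then obtain X where "X \<subseteq> carrier K" "Y = f ` X" by (meson subset_imageE)
    then show "Y \<in> (`) f ` Sub K" using Y iff by (auto simp: Sub_def)
  next
    fix Y assume "Y \<in> (`) f ` Sub K"
    then show "Y \<in> Sub L" using iff by (auto simp: Sub_def) (metis subuniverse_def)
  qed
  moreover have "inj_on ((`) f) (Sub K)"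
    by (rule inj_on_subset[OF inj_on_image_Pow[OF inj]]) (auto simp: Sub_def subuniverse_def)
  ultimately show ?thesis by (simp add: card_image)
qed

lemma finite_lattice_nat_copy:
  fixes L :: "'a gorder"
  assumes "finite_lattice L"
  obtains M :: "nat gorder" where "finite_lattice M" "lattice_iso L M"
proof -
  have L: "lattice L" and fin: "finite (carrier L)" and ne: "carrier L \<noteq> {}"
    using assms by (auto simp: finite_lattice_def)
  interpret L: lattice L by (rule L)
  obtain g where g: "bij_betw g {0..<card (carrier L)} (carrier L)"
    using ex_bij_betw_nat_finite[OF fin] by blast
  define N where "N = {0..<card (carrier L)}"
  define f where "f = inv_into N g"
  define M :: "nat gorder" where "M = \<lparr>carrier = N, eq = (=), le = (\<lambda>i j. g i \<sqsubseteq>\<^bsub>L\<^esub> g j)\<rparr>"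
  have bg: "bij_betw g N (carrier L)" using g by (simp add: N_def)
  have bf: "bij_betw f (carrier L) N" unfolding f_def by (rule bij_betw_inv_into[OF bg])
  have gc: "g i \<in> carrier L" if "i \<in> N" for i using bg that by (auto simp: bij_betw_def)
  have fc: "f x \<in> N" if "x \<in> carrier L" for x using bf that by (auto simp: bij_betw_def)
  have gf: "g (f x) = x" if "x \<in> carrier L" for x
    using bg that by (simp add: f_def bij_betw_inv_into_right)
  have fg: "f (g i) = i" if "i \<in> N" for i
    using bg that by (simp add: f_def bij_betw_inv_into_left)
  have po: "partial_order M"
    apply unfold_locales
    using gc L.le_refl apply (auto simp: M_def)
    apply (metis L.le_antisym fg gc)
    by (meson L.le_trans gc)
  have lub: "least M (f (g i \<squnion>\<^bsub>L\<^esub> g j)) (Upper M {i, j})" if "i \<in> N" "j \<in> N" for i j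
  proof -
    have c: "g i \<in> carrier L" "g j \<in> carrier L" using gc that by auto
    note jc = L.join_closed[OF c]
    show ?thesis
      unfolding least_def Upper_def
      using that c fc[OF jc] gf[OF jc] gc L.join_left[OF c] L.join_right[OF c]
        L.join_le[OF _ _ c gc]
      by (auto simp: M_def gf[OF jc])
  qed
  have glb: "greatest M (f (g i \<sqinter>\<^bsub>L\<^esub> g j)) (Lower M {i, j})" if "i \<in> N" "j \<in> N" for i j
  proof -
    have c: "g i \<in> carrier L" "g j \<in> carrier L" using gc that by auto
    note mc = L.meet_closed[OF c]
    show ?thesis
      unfolding greatest_def Lower_def
      using that c fc[OF mc] gf[OF mc] gc L.meet_left[OF c] L.meet_right[OF c]
        L.meet_le[OF _ _ c(1) c(2) gc]
      by (auto simp: M_def gf[OF mc])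
  qed
  interpret M: partial_order M by (rule po)
  have latM: "lattice M"
    proof
    fix i j assume "i \<in> carrier M" "j \<in> carrier M"
    then have ij: "i \<in> N" "j \<in> N" by (simp_all add: M_def)
    show "\<exists>s. least M s (Upper M {i, j})" using lub[OF ij] by blast
    show "\<exists>s. greatest M s (Lower M {i, j})" using glb[OF ij] by blast
  qed
  interpret M: lattice M by (rule latM)
  have js: "f (x \<squnion>\<^bsub>L\<^esub> y) = f x \<squnion>\<^bsub>M\<^esub> f y" if "x \<in> carrier L" "y \<in> carrier L" for x y
  proof -
    have "least M (f (x \<squnion>\<^bsub>L\<^esub> y)) (Upper M {f x, f y})"
      using lub[OF fc[OF that(1)] fc[OF that(2)]] gf that by simp
    from M.least_unique[OF this someI[of "\<lambda>s. least M s (Upper M {f x, f y})", OF this]]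
    show ?thesis by (simp only: join_def[of M] sup_def[of M])
  qed
  have ms: "f (x \<sqinter>\<^bsub>L\<^esub> y) = f x \<sqinter>\<^bsub>M\<^esub> f y" if "x \<in> carrier L" "y \<in> carrier L" for x y
  proof -
    have "greatest M (f (x \<sqinter>\<^bsub>L\<^esub> y)) (Lower M {f x, f y})"
      using glb[OF fc[OF that(1)] fc[OF that(2)]] gf that by simp
    from M.greatest_unique[OF this someI[of "\<lambda>s. greatest M s (Lower M {f x, f y})", OF this]]
    show ?thesis by (simp only: meet_def[of M] inf_def[of M])
  qed
  have "finite_lattice M"
    using latM fin ne bf by (auto simp: finite_lattice_def M_def N_def card_gt_0_iff)
  moreover have "lattice_iso L M"
    unfolding lattice_iso_def join_pres_def meet_pres_def
    using bf js ms L latM by (auto simp: M_def)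
  ultimately show thesis by (rule that)
qed

lemma card_Sub_in_NS:
  fixes L :: "'a gorder"
  assumes "finite_lattice L"
  shows "card (Sub L) \<in> NS (card (carrier L))"
proof -
  obtain M :: "nat gorder" where M: "finite_lattice M" "lattice_iso L M"
    using finite_lattice_nat_copy[OF assms] .
  have "card (carrier L) = card (carrier M)"
    using M(2) by (auto simp: lattice_iso_def intro: bij_betw_same_card)
  then show ?thesis
    using M card_Sub_lattice_iso[OF M(2)] by (auto simp: NS_def)
qed

end

theory Submission
  imports Defs
begin

text \<open>
  A subset of a lattice fails to be a subuniverse exactly when it contains an incomparable pair
  \<open>a, b\<close> but misses the join or the meet. A single pair excludes
  \<open>3/16 = 6/32\<close> of all subsets. Two disjoint incomparable pairs jointly exclude at least
  \<open>6/32 + 6/32 - 2/32\<close>, leaving at most \<open>22/32\<close>. Pairs \<open>{a, b}\<close>, \<open>{a, c}\<close> jointly exclude at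
  least \<open>6/32 + 6/32 - 3/32\<close>, leaving at most \<open>23/32\<close>. Any further incomparable pair is itself
  an excluded two-element set not yet counted, so equality depends only on the set of
  incomparable pairs. If every incomparable pair contains \<open>a\<close>, an element comparable with \<open>a\<close>
  lies below all the meets or above all the joins, which gives the glued sum decomposition.
\<close>

subsection \<open>Counting excluded subsets\<close>

text \<open>Both the number of subuniverses and the shape of the lattice are computed from
  \<open>incomp_pairs\<close>; a count and a glued sum are never compared directly, and the converse
  directions only read off the incomparable pairs of a glued sum. In units of
  \<open>2 ^ (n - 5)\<close>, a pair has 8 units of supersets, of which 2 also contain join and
  meet: hence 6. For disjoint pairs the overlap lies among the supersets of four elements, 2 units.
  For pairs sharing \<open>a\<close> it lies among the 4 units of supersets of
  \<open>{a, b, c}\<close>, less the 1 unit that also contains the join and meet of \<open>a\<close>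
  and \<open>b\<close>. The obstacle is that 23 is both the general bound for pairs sharing an
  element and an attained value, so the bound has to be strict outside a single configuration. In
  that configuration it is attained because \<open>b\<close> and \<open>c\<close> are comparable,
  which forces them to have the same join and the same meet with \<open>a\<close>.\<close>

lemma card_supersets:
  assumes "finite A" "S \<subseteq> A"
  shows "card {X. X \<subseteq> A \<and> S \<subseteq> X} = 2 ^ (card A - card S)"
proof -
  have "bij_betw (\<lambda>Y. Y \<union> S) (Pow (A - S)) {X. X \<subseteq> A \<and> S \<subseteq> X}"
    by (rule bij_betw_byWitness[where f' = "\<lambda>X. X - S"]) (use assms(2) in auto)
  then have "card {X. X \<subseteq> A \<and> S \<subseteq> X} = card (Pow (A - S))"
    by (simp add: bij_betw_same_card)
  also have "\<dots> = 2 ^ (card A - card S)"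
    using assms by (simp add: card_Pow card_Diff_subset finite_subset)
  finally show ?thesis .
qed

text \<open>The supersets of \<open>S\<close> split according to whether they contain
  \<open>T\<close>. The sum form avoids truncated subtraction on \<open>nat\<close>.\<close>

lemma card_supersets_Diff:
  assumes "finite A" "T \<subseteq> A" "S \<subseteq> T"
  shows "card {X. X \<subseteq> A \<and> S \<subseteq> X \<and> \<not> T \<subseteq> X} + 2 ^ (card A - card T) = 2 ^ (card A - card S)"
proof -
  let ?U = "{X. X \<subseteq> A \<and> S \<subseteq> X \<and> \<not> T \<subseteq> X}"
  let ?V = "{X. X \<subseteq> A \<and> T \<subseteq> X}"
  have "?U \<union> ?V = {X. X \<subseteq> A \<and> S \<subseteq> X}" using assms(3) by blast
  moreover have "card (?U \<union> ?V) = card ?U + card ?V"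
    by (rule card_Un_disjoint) (use assms(1) in auto)
  ultimately show ?thesis
    using card_supersets[OF assms(1,2)] card_supersets[OF assms(1) order_trans[OF assms(3,2)]] by simp
qed

section \<open>Incomparable pairs and the subsets they exclude\<close>

definition incomp :: "'a gorder \<Rightarrow> 'a \<Rightarrow> 'a \<Rightarrow> bool" where
  "incomp L x y \<longleftrightarrow>
     x \<in> carrier L \<and> y \<in> carrier L \<and> \<not> x \<sqsubseteq>\<^bsub>L\<^esub> y \<and> \<not> y \<sqsubseteq>\<^bsub>L\<^esub> x"

definition incomp_pairs :: "'a gorder \<Rightarrow> 'a set set" where
  "incomp_pairs L = {{x, y} |x y. incomp L x y}"

text \<open>Phrased as containing one set but not a larger one, which is the shape counted by
  \<open>card_supersets_Diff\<close>.\<close>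

definition violations :: "'a gorder \<Rightarrow> 'a \<Rightarrow> 'a \<Rightarrow> 'a set set" where
  "violations L a b = {X. X \<subseteq> carrier L \<and> {a, b} \<subseteq> X \<and> \<not> {a, b, a \<squnion>\<^bsub>L\<^esub> b, a \<sqinter>\<^bsub>L\<^esub> b} \<subseteq> X}"

lemma incomp_sym: "incomp L x y \<longleftrightarrow> incomp L y x"
  by (auto simp: incomp_def)

lemma mem_incomp_pairs: "{x, y} \<in> incomp_pairs L \<longleftrightarrow> incomp L x y"
  unfolding incomp_pairs_def by (auto simp: doubleton_eq_iff incomp_sym)

locale fin_lattice = lattice L for L :: "'a gorder" (structure) +
  assumes fin: "finite (carrier L)"
begin

lemma incomp_join_meet:
  assumes "incomp L a b"
  shows "a \<in> carrier L" "b \<in> carrier L" "a \<noteq> b"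
    "a \<squnion> b \<in> carrier L" "a \<sqinter> b \<in> carrier L"
    "a \<squnion> b \<noteq> a" "a \<squnion> b \<noteq> b" "a \<sqinter> b \<noteq> a" "a \<sqinter> b \<noteq> b" "a \<squnion> b \<noteq> a \<sqinter> b"
proof -
  have ab: "a \<in> carrier L" "b \<in> carrier L" "\<not> a \<sqsubseteq> b" "\<not> b \<sqsubseteq> a"
    using assms by (auto simp: incomp_def)
  then show "a \<in> carrier L" "b \<in> carrier L" "a \<noteq> b"
    "a \<squnion> b \<in> carrier L" "a \<sqinter> b \<in> carrier L" by auto
  show "a \<squnion> b \<noteq> a" "a \<squnion> b \<noteq> b" using join_left join_right ab by metis+
  show "a \<sqinter> b \<noteq> a" "a \<sqinter> b \<noteq> b" using meet_left meet_right ab by metis+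
  \<comment> \<open>Equality would give \<open>a \<sqsubseteq> a \<squnion> b = a \<sqinter> b
    \<sqsubseteq> b\<close>.\<close>
  show "a \<squnion> b \<noteq> a \<sqinter> b"
    using ab join_left meet_right le_trans join_closed by metis
qed

text \<open>The join and meet of two comparable elements are those elements themselves, so only
  incomparable pairs can break closure.\<close>

lemma Sub_eq_Diff_violations:
  "Sub L = Pow (carrier L) - (\<Union>(a, b)\<in>{(a, b). incomp L a b}. violations L a b)"
proof -
  have comp: "x \<squnion> y \<in> X \<and> x \<sqinter> y \<in> X"
    if "X \<subseteq> carrier L" "x \<in> X" "y \<in> X" "\<not> incomp L x y" for X x y
  proof -
    have "x \<in> carrier L" "y \<in> carrier L" "x \<sqsubseteq> y \<or> y \<sqsubseteq> x"
      using that by (auto simp: incomp_def)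
    then show ?thesis
      using that(2,3) by (metis join_comm le_iff_join le_iff_meet meet_comm)
  qed
  have "X \<in> Sub L \<longleftrightarrow> X \<subseteq> carrier L \<and> (\<forall>a b. incomp L a b \<longrightarrow> X \<notin> violations L a b)" for X
  proof -
    have "X \<in> Sub L \<longleftrightarrow>
        X \<subseteq> carrier L \<and> (\<forall>x\<in>X. \<forall>y\<in>X. incomp L x y \<longrightarrow> x \<squnion> y \<in> X \<and> x \<sqinter> y \<in> X)"
      unfolding Sub_def subuniverse_def mem_Collect_eq using comp by blast
    then show ?thesis unfolding violations_def by blast
  qed
  then show ?thesis by blast
qed

lemma card_Sub_add_card_violations:
  "card (Sub L) + card (\<Union>(a, b)\<in>{(a, b). incomp L a b}. violations L a b)
    = 2 ^ card (carrier L)"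
proof -
  let ?V = "\<Union>(a, b)\<in>{(a, b). incomp L a b}. violations L a b"
  have sub: "?V \<subseteq> Pow (carrier L)" by (auto simp: violations_def)
  have finP: "finite (Pow (carrier L))" using fin by simp
  have "card (Sub L) = card (Pow (carrier L)) - card ?V"
    unfolding Sub_eq_Diff_violations by (rule card_Diff_subset[OF finite_subset[OF sub finP] sub])
  then show ?thesis using card_mono[OF finP sub] fin by (simp add: card_Pow)
qed

text \<open>An incomparable pair with its join and meet makes four distinct elements, so
  \<open>2 ^ (n - 2) - 2 ^ (n - 4)\<close> subsets contain the pair but not all four.\<close>

lemma card_violations:
  assumes "incomp L a b"
  shows "card (violations L a b) = 3 * 2 ^ (card (carrier L) - 4)" and "4 \<le> card (carrier L)"
proof -
  note ab = incomp_join_meet[OF assms(1)]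
  have sub: "{a, b, a \<squnion> b, a \<sqinter> b} \<subseteq> carrier L" using ab by auto
  have c4: "card {a, b, a \<squnion> b, a \<sqinter> b} = 4" using ab by auto
  show le: "4 \<le> card (carrier L)" using card_mono[OF fin sub] c4 by simp
  have "card (violations L a b) + 2 ^ (card (carrier L) - 4) = 2 ^ (card (carrier L) - 2)"
    using card_supersets_Diff[OF fin sub, of "{a, b}"] c4 ab
    by (simp add: violations_def)
  moreover have "card (carrier L) - 2 = Suc (Suc (card (carrier L) - 4))" using le by simp
  ultimately show "card (violations L a b) = 3 * 2 ^ (card (carrier L) - 4)" by simp
qed

lemma violations_commute:
  assumes "{a, b} = {c, d}"
  shows "violations L a b = violations L c d"
  using assms unfolding doubleton_eq_iff violations_def
  by (auto simp: join_comm meet_comm)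

lemma pair_in_violations:
  assumes "incomp L a b"
  shows "{a, b} \<in> violations L a b"
  using incomp_join_meet[OF assms] by (auto simp: violations_def)

text \<open>Used in contrapositive form: a two-element set different from \<open>{a, b}\<close> is
  not among the violations of \<open>a, b\<close>, which is what makes a further pair contribute
  something new.\<close>

lemma in_violations_pair: "{d, e} \<in> violations L a b \<Longrightarrow> incomp L a b \<Longrightarrow> {a, b} = {d, e}"
  using incomp_join_meet[of a b] by (auto simp: violations_def)

lemma finite_violations: "finite (violations L a b)"
  by (rule finite_subset[of _ "Pow (carrier L)"]) (auto simp: violations_def fin)

lemma card_Sub_no_incomp:
  assumes "incomp_pairs L = {}"
  shows "card (Sub L) = 2 ^ card (carrier L)"
proof -
  have "\<not> incomp L a b" for a b using assms mem_incomp_pairs[of a b L] by simp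
  then show ?thesis using card_Sub_add_card_violations by simp
qed

lemma card_Sub_one_incomp:
  assumes "incomp_pairs L = {{a, b}}"
  shows "card (Sub L) = 13 * 2 ^ (card (carrier L) - 4)"
proof -
  have ab: "incomp L a b" using assms mem_incomp_pairs[of a b L] by simp
  have "violations L c d = violations L a b" if "incomp L c d" for c d
    using violations_commute[of c d a b] that assms mem_incomp_pairs[of c d L] by simp
  then have "(\<Union>(c, d)\<in>{(c, d). incomp L c d}. violations L c d) = violations L a b"
    using ab by blast
  moreover have "(2::nat) ^ card (carrier L) = 16 * 2 ^ (card (carrier L) - 4)"
    using power_add[of "2::nat" 4 "card (carrier L) - 4"] card_violations(2)[OF ab] by simp
  ultimately show ?thesis
    using card_Sub_add_card_violations card_violations(1)[OF ab] by simp
qed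

section \<open>Bounds forced by two incomparable pairs\<close>

lemma card_Sub_add_union_le:
  assumes "incomp L a b" "incomp L c d"
  shows "card (Sub L) + card (violations L a b \<union> violations L c d) \<le> 2 ^ card (carrier L)"
proof -
  have "card (violations L a b \<union> violations L c d)
      \<le> card (\<Union>(a, b)\<in>{(a, b). incomp L a b}. violations L a b)"
  proof (rule card_mono)
    show "finite (\<Union>(a, b)\<in>{(a, b). incomp L a b}. violations L a b)"
      by (rule finite_subset[of _ "Pow (carrier L)"]) (use fin in \<open>auto simp: violations_def\<close>)
  qed (use assms in blast)
  then show ?thesis using card_Sub_add_card_violations by linarith
qed

lemma card_Sub_add_union_less:
  assumes "incomp L a b" "incomp L c d"
    and "incomp L x y" "{x, y} \<noteq> {a, b}" "{x, y} \<noteq> {c, d}"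
  shows "card (Sub L) + card (violations L a b \<union> violations L c d) < 2 ^ card (carrier L)"
proof -
  have "card (violations L a b \<union> violations L c d)
      < card (\<Union>(a, b)\<in>{(a, b). incomp L a b}. violations L a b)"
  proof (rule psubset_card_mono)
    show "finite (\<Union>(a, b)\<in>{(a, b). incomp L a b}. violations L a b)"
      by (rule finite_subset[of _ "Pow (carrier L)"]) (use fin in \<open>auto simp: violations_def\<close>)
    have "{x, y} \<notin> violations L a b \<union> violations L c d"
      using in_violations_pair assms by (metis UnE)
    then show "violations L a b \<union> violations L c d
        \<subset> (\<Union>(a, b)\<in>{(a, b). incomp L a b}. violations L a b)"
      using pair_in_violations[OF assms(3)] assms by blast
  qed
  then show ?thesis using card_Sub_add_card_violations by linarith
qed

text \<open>A subset violating both pairs contains all of \<open>a, b, c, d\<close>, so the overlap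
  is at most one unit of \<open>2 ^ (n - 4)\<close> and at most \<open>16 - (3 + 3 - 1) = 11\<close>
  units remain. The join or meet of one pair may belong to the other pair, so this is only an upper
  bound.\<close>

lemma card_Sub_disjoint_incomp:
  assumes "incomp L a b" "incomp L c d" "{a, b} \<inter> {c, d} = {}"
  shows "card (Sub L) \<le> 11 * 2 ^ (card (carrier L) - 4)"
proof -
  let ?n = "card (carrier L)" and ?A = "violations L a b" and ?B = "violations L c d"
  have n: "4 \<le> ?n" using card_violations(2) assms by blast
  have S: "{a, b, c, d} \<subseteq> carrier L" "card {a, b, c, d} = 4"
    using incomp_join_meet[OF assms(1)] incomp_join_meet[OF assms(2)] assms(3) by auto
  have "card (?A \<inter> ?B) \<le> card {X. X \<subseteq> carrier L \<and> {a, b, c, d} \<subseteq> X}"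
    by (rule card_mono) (use fin in \<open>auto simp: violations_def\<close>)
  also have "\<dots> = 2 ^ (?n - 4)" using card_supersets[OF fin S(1)] S(2) by simp
  finally have i: "card (?A \<inter> ?B) \<le> 2 ^ (?n - 4)" .
  have "card (?A \<union> ?B) + card (?A \<inter> ?B) = 2 * (3 * 2 ^ (?n - 4))"
    using card_Un_Int[of ?A ?B] finite_violations card_violations(1) assms
    by simp
  moreover have "(2::nat) ^ ?n = 16 * 2 ^ (?n - 4)"
    using power_add[of "2::nat" 4 "?n - 4"] n by simp
  ultimately show ?thesis using card_Sub_add_union_le[OF assms(1,2)] i by linarith
qed

text \<open>The join and meet of \<open>a\<close> and \<open>b\<close> are comparable with
  \<open>a\<close>, whereas \<open>c\<close> is not.\<close>

lemma card_three_join_meet: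
  assumes "incomp L a b" "incomp L a c" "b \<noteq> c"
  shows "card {a, b, c, a \<squnion> b, a \<sqinter> b} = 5"
proof -
  note c = incomp_join_meet(1,2)[OF assms(1)]
  have "a \<squnion> b \<noteq> c" "a \<sqinter> b \<noteq> c"
    using join_left[OF c] meet_left[OF c] assms(2) unfolding incomp_def by metis+
  then show ?thesis
    using incomp_join_meet[OF assms(1)] incomp_join_meet(3)[OF assms(2)] assms(3) by auto
qed

text \<open>\<open>T\<close> drops the requirement that the pair \<open>a, c\<close> be violated as
  well. This makes it countable without knowing how the two joins and the two meets are related:
  \<open>4 - 1 = 3\<close> units.\<close>

lemma card_violations_Int:
  assumes "incomp L a b" "incomp L a c" "b \<noteq> c"
  defines "T \<equiv> {X. X \<subseteq> carrier L \<and> {a, b, c} \<subseteq> X \<and> \<not> {a, b, c, a \<squnion> b, a \<sqinter> b} \<subseteq> X}"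
  shows "violations L a b \<inter> violations L a c \<subseteq> T" "finite T"
    "card T = 3 * 2 ^ (card (carrier L) - 5)" "5 \<le> card (carrier L)"
proof -
  let ?n = "card (carrier L)"
  show "violations L a b \<inter> violations L a c \<subseteq> T" "finite T"
    using fin by (auto simp: T_def violations_def)
  have sub: "{a, b, c, a \<squnion> b, a \<sqinter> b} \<subseteq> carrier L"
    using incomp_join_meet[OF assms(1)] incomp_join_meet[OF assms(2)] by simp
  note c5 = card_three_join_meet[OF assms(1-3)]
  show n: "5 \<le> ?n" using card_mono[OF fin sub] c5 by simp
  have "card {a, b, c} = 3"
    using incomp_join_meet(3)[OF assms(1)] incomp_join_meet(3)[OF assms(2)] assms(3) by simp
  then have "card T + 2 ^ (?n - 5) = 2 ^ (?n - 3)"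
    using card_supersets_Diff[OF fin sub, of "{a, b, c}"] c5 unfolding T_def by simp
  moreover have "?n - 3 = Suc (Suc (?n - 5))" using n by simp
  ultimately show "card T = 3 * 2 ^ (?n - 5)" by simp
qed

lemma card_violations_Un:
  assumes "incomp L a b" "incomp L a c" "b \<noteq> c"
  shows "9 * 2 ^ (card (carrier L) - 5) \<le> card (violations L a b \<union> violations L a c)"
    and "a \<squnion> b = a \<squnion> c \<Longrightarrow> a \<sqinter> b = a \<sqinter> c \<Longrightarrow>
      card (violations L a b \<union> violations L a c) = 9 * 2 ^ (card (carrier L) - 5)"
proof -
  let ?n = "card (carrier L)" and ?A = "violations L a b" and ?B = "violations L a c"
  let ?T = "{X. X \<subseteq> carrier L \<and> {a, b, c} \<subseteq> X \<and> \<not> {a, b, c, a \<squnion> b, a \<sqinter> b} \<subseteq> X}"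
  note T = card_violations_Int[OF assms]
  have "?n - 4 = Suc (?n - 5)" using T(4) by simp
  then have AB: "card ?A = 6 * 2 ^ (?n - 5)" "card ?B = 6 * 2 ^ (?n - 5)"
    using card_violations(1)[OF assms(1)] card_violations(1)[OF assms(2)] by simp_all
  have un: "card (?A \<union> ?B) + card (?A \<inter> ?B) = 12 * 2 ^ (?n - 5)"
    using card_Un_Int[OF finite_violations finite_violations, of a b a c] AB by simp
  show "9 * 2 ^ (?n - 5) \<le> card (?A \<union> ?B)"
    using un card_mono[OF T(2,1)] T(3) by linarith
  \<comment> \<open>With common join and meet, violating one pair is the same as violating the
    other, so the overlap is all of \<open>T\<close>.\<close>
  assume "a \<squnion> b = a \<squnion> c" "a \<sqinter> b = a \<sqinter> c"
  then have "?T \<subseteq> ?A \<inter> ?B" unfolding violations_def by auto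
  then have "card (?A \<inter> ?B) = 3 * 2 ^ (?n - 5)" using T(3) subset_antisym[OF T(1)] by simp
  then show "card (?A \<union> ?B) = 9 * 2 ^ (?n - 5)" using un by linarith
qed

lemma power_card_carrier:
  assumes "5 \<le> card (carrier L)"
  shows "(2::nat) ^ card (carrier L) = 32 * 2 ^ (card (carrier L) - 5)"
  using power_add[of "2::nat" 5 "card (carrier L) - 5"] assms by simp

text \<open>At least 9 of the 32 units are gone already, and the further pair removes at least one
  more subset. Incomparable \<open>b\<close> and \<open>c\<close> fall under this lemma, with
  \<open>{b, c}\<close> as the further pair.\<close>

lemma card_Sub_two_incomp_less:
  assumes "incomp L a b" "incomp L a c" "b \<noteq> c"
    and "incomp L x y" "{x, y} \<noteq> {a, b}" "{x, y} \<noteq> {a, c}"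
  shows "card (Sub L) < 23 * 2 ^ (card (carrier L) - 5)"
  using card_Sub_add_union_less[OF assms(1,2,4,5,6)] card_violations_Un(1)[OF assms(1-3)]
    power_card_carrier[OF card_violations_Int(4)[OF assms(1-3)]]
  by linarith

text \<open>\<open>a \<squnion> b \<sqsubseteq> c\<close> would put \<open>a\<close> below
  \<open>c\<close>, so comparability leaves \<open>c \<sqsubseteq> a \<squnion> b\<close>, and the
  larger join collapses onto the smaller one.\<close>

lemma incomp_chain_join:
  assumes "incomp L a b" "incomp L a c" "b \<sqsubseteq> c" "\<not> incomp L (a \<squnion> b) c"
  shows "a \<squnion> b = a \<squnion> c"
proof -
  have c: "a \<in> carrier L" "b \<in> carrier L" "c \<in> carrier L" using assms by (auto simp: incomp_def)
  note j1 = join_closed[OF c(1,2)] join_left[OF c(1,2)] join_right[OF c(1,2)]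
  note j2 = join_closed[OF c(1,3)] join_left[OF c(1,3)] join_right[OF c(1,3)]
  have "\<not> a \<squnion> b \<sqsubseteq> c"
    using le_trans[OF j1(2) _ c(1) j1(1) c(3)] assms(2) by (auto simp: incomp_def)
  then have "c \<sqsubseteq> a \<squnion> b" using assms(4) c j1 by (auto simp: incomp_def)
  then have "a \<squnion> c \<sqsubseteq> a \<squnion> b" using join_le j1 c by blast
  moreover have "b \<sqsubseteq> a \<squnion> c" using le_trans[OF assms(3) j2(3) c(2,3) j2(1)] .
  then have "a \<squnion> b \<sqsubseteq> a \<squnion> c" using join_le j2 c by blast
  ultimately show ?thesis using le_antisym j1 j2 by blast
qed

text \<open>The dual argument: \<open>b \<sqsubseteq> a \<sqinter> c\<close> would put
  \<open>b\<close> below \<open>a\<close>.\<close>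

lemma incomp_chain_meet:
  assumes "incomp L a b" "incomp L a c" "b \<sqsubseteq> c" "\<not> incomp L (a \<sqinter> c) b"
  shows "a \<sqinter> b = a \<sqinter> c"
proof -
  have c: "a \<in> carrier L" "b \<in> carrier L" "c \<in> carrier L" using assms by (auto simp: incomp_def)
  note m1 = meet_closed[OF c(1,2)] meet_left[OF c(1,2)] meet_right[OF c(1,2)]
  note m2 = meet_closed[OF c(1,3)] meet_left[OF c(1,3)] meet_right[OF c(1,3)]
  have "\<not> b \<sqsubseteq> a \<sqinter> c"
    using le_trans[OF _ m2(2) c(2) m2(1) c(1)] assms(1) by (auto simp: incomp_def)
  then have "a \<sqinter> c \<sqsubseteq> b" using assms(4) c m2 by (auto simp: incomp_def)
  then have "a \<sqinter> c \<sqsubseteq> a \<sqinter> b" using meet_le m2 c by blast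
  moreover have "a \<sqinter> b \<sqsubseteq> c" using le_trans[OF m1(3) assms(3) m1(1) c(2,3)] .
  then have "a \<sqinter> b \<sqsubseteq> a \<sqinter> c" using meet_le m1 c by blast
  ultimately show ?thesis using le_antisym m1 m2 by blast
qed

lemma incomp_pairs_two:
  assumes "incomp_pairs L = {{a, b}, {a, c}}" "b \<noteq> c"
  shows "incomp L a b" "incomp L a c" "a \<squnion> b = a \<squnion> c" "a \<sqinter> b = a \<sqinter> c" "\<not> incomp L b c"
proof -
  have iff: "incomp L x y \<longleftrightarrow> {x, y} = {a, b} \<or> {x, y} = {a, c}" for x y
    using assms(1) mem_incomp_pairs[of x y L] by simp
  show ab: "incomp L a b" and ac: "incomp L a c" by (simp_all add: iff)
  note jm = incomp_join_meet[OF ab] incomp_join_meet[OF ac]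
  have ne: "a \<noteq> b" "a \<noteq> c" using jm by simp_all
  show nbc: "\<not> incomp L b c" using ne assms(2) by (auto simp: iff doubleton_eq_iff)
  have comp: "\<not> incomp L x y" if "x \<noteq> a" "y \<noteq> a" for x y
    using that by (auto simp: iff doubleton_eq_iff)
  \<comment> \<open>None of these pairs contains \<open>a\<close>. The first two facts serve the
    case \<open>b \<sqsubseteq> c\<close>, the last two the case
    \<open>c \<sqsubseteq> b\<close>.\<close>
  have "\<not> incomp L (a \<squnion> b) c" "\<not> incomp L (a \<sqinter> c) b" "\<not> incomp L (a \<squnion> c) b" "\<not> incomp L (a \<sqinter> b) c"
    using comp jm by metis+
  moreover have "b \<sqsubseteq> c \<or> c \<sqsubseteq> b" using nbc jm by (auto simp: incomp_def)
  ultimately show "a \<squnion> b = a \<squnion> c" "a \<sqinter> b = a \<sqinter> c"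
    using incomp_chain_join incomp_chain_meet ab ac by metis+
qed

lemma card_Sub_two_incomp:
  assumes "incomp_pairs L = {{a, b}, {a, c}}" "b \<noteq> c"
  shows "card (Sub L) = 23 * 2 ^ (card (carrier L) - 5)"
proof -
  note abc = incomp_pairs_two[OF assms]
  have "violations L x y = violations L a b \<or> violations L x y = violations L a c" if "incomp L x y" for x y
    using violations_commute[of x y a b] violations_commute[of x y a c] that
      assms(1) mem_incomp_pairs[of x y L] by auto
  then have "(\<Union>(c, d)\<in>{(c, d). incomp L c d}. violations L c d)
      = violations L a b \<union> violations L a c"
    using abc(1,2) by blast
  then have "card (Sub L) + 9 * 2 ^ (card (carrier L) - 5) = 2 ^ card (carrier L)"
    using card_Sub_add_card_violations card_violations_Un(2)[OF abc(1,2) assms(2) abc(3,4)] by simp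
  then show ?thesis
    using power_card_carrier[OF card_violations_Int(4)[OF abc(1,2) assms(2)]] by linarith
qed

text \<open>Each case pairs a configuration with its value. As the four values or ranges exclude
  each other, the lemma can also be read backwards, from the count to the configuration.\<close>

lemma card_Sub_cases:
  assumes n: "5 \<le> card (carrier L)"
  obtains "incomp_pairs L = {}" "card (Sub L) = 32 * 2 ^ (card (carrier L) - 5)"
  | a b where "incomp_pairs L = {{a, b}}" "card (Sub L) = 26 * 2 ^ (card (carrier L) - 5)"
  | a b c where "incomp_pairs L = {{a, b}, {a, c}}" "b \<noteq> c"
      "card (Sub L) = 23 * 2 ^ (card (carrier L) - 5)"
  | "card (Sub L) < 23 * 2 ^ (card (carrier L) - 5)"
proof -
  have n4: "(2::nat) ^ (card (carrier L) - 4) = 2 * 2 ^ (card (carrier L) - 5)"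
  proof -
    have "card (carrier L) - 4 = Suc (card (carrier L) - 5)" using n by simp
    then show ?thesis by simp
  qed
  show thesis
  proof (cases "incomp_pairs L = {}")
    case True
    then show thesis using that(1) card_Sub_no_incomp power_card_carrier[OF n] by simp
  next
    case False
    then obtain a b where ab: "incomp L a b" by (auto simp: incomp_pairs_def)
    show thesis
    proof (cases "incomp_pairs L = {{a, b}}")
      case True
      then show thesis using that(2) card_Sub_one_incomp[OF True] n4 by simp
    next
      case False
      then obtain d e where de: "incomp L d e" "{d, e} \<noteq> {a, b}"
        using ab unfolding incomp_pairs_def by blast
      show thesis
      proof (cases "{a, b} \<inter> {d, e} = {}")
        case True
        \<comment> \<open>The 11 units of \<open>2 ^ (n - 4)\<close> are 22 units of
          \<open>2 ^ (n - 5)\<close>; positivity of the unit makes the inequality strict.\<close>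
        then have "card (Sub L) < 23 * 2 ^ (card (carrier L) - 5)"
          using card_Sub_disjoint_incomp[OF ab de(1)] n4
            zero_less_power[of "2::nat" "card (carrier L) - 5"]
          by linarith
        then show thesis by (rule that(4))
      next
        case False
        then obtain p q r where pqr: "incomp L p q" "incomp L p r" "q \<noteq> r"
        proof -
          consider "a = d" | "a = e" | "b = d" | "b = e" using False by blast
          then show thesis
          proof cases
            case 1
            then show thesis using that[of a b e] ab de by auto
          next
            case 2
            then show thesis using that[of a b d] ab de incomp_sym[of L d e] by auto
          next
            case 3
            then show thesis using that[of b a e] ab de incomp_sym[of L a b] by auto
          next
            case 4
            then show thesis using that[of b a d] ab de incomp_sym[of L a b] incomp_sym[of L d e] by auto
          qed
        qed
        show thesis
        proof (cases "incomp_pairs L = {{p, q}, {p, r}}")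
          case True
          then show thesis using that(3)[OF True pqr(3)] card_Sub_two_incomp[OF True pqr(3)] by simp
        next
          case False
          then obtain x y where "incomp L x y" "{x, y} \<noteq> {p, q}" "{x, y} \<noteq> {p, r}"
            using pqr unfolding incomp_pairs_def by blast
          then show thesis using that(4) card_Sub_two_incomp_less[OF pqr] by blast
        qed
      qed
    qed
  qed
qed

end

subsection \<open>Order isomorphisms and glued sums\<close>

text \<open>Only orders are compared, so that no join or meet of a glued sum has to be calculated;
  \<open>order_iso_imp_lattice_iso\<close> converts afterwards. The map is an argument because
  isomorphisms of pieces are later glued together.\<close>

definition order_iso :: "'a gorder \<Rightarrow> 'b gorder \<Rightarrow> ('a \<Rightarrow> 'b) \<Rightarrow> bool" where
  "order_iso P Q f \<longleftrightarrow> bij_betw f (carrier P) (carrier Q) \<and>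
     (\<forall>x\<in>carrier P. \<forall>y\<in>carrier P. f x \<sqsubseteq>\<^bsub>Q\<^esub> f y \<longleftrightarrow> x \<sqsubseteq>\<^bsub>P\<^esub> y)"

lemma order_isoI:
  assumes "partial_order P" "f ` carrier P = carrier Q"
    and "\<And>x y. x \<in> carrier P \<Longrightarrow> y \<in> carrier P \<Longrightarrow> f x \<sqsubseteq>\<^bsub>Q\<^esub> f y \<longleftrightarrow> x \<sqsubseteq>\<^bsub>P\<^esub> y"
  shows "order_iso P Q f"
proof -
  interpret partial_order P by (rule assms(1))
  have "inj_on f (carrier P)"
    by (rule inj_onI) (metis assms(3) le_antisym le_refl)
  then show ?thesis using assms(2,3) by (simp add: order_iso_def bij_betw_def)
qed

text \<open>\<open>M\<close> is not assumed to be a lattice, nor even ordered: transitivity,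
  antisymmetry, joins and meets are all transported along \<open>f\<close>. Since a
  \<open>gorder\<close> carries its own equality, \<open>eq M = (=)\<close> has to be required
  separately.\<close>

lemma order_iso_imp_lattice_iso:
  assumes "lattice L" "order_iso L M f" "eq M = (=)"
  shows "lattice_iso L M"
proof -
  interpret L: lattice L by (rule assms(1))
  have bij: "bij_betw f (carrier L) (carrier M)"
    and le: "\<And>x y. x \<in> carrier L \<Longrightarrow> y \<in> carrier L \<Longrightarrow> f x \<sqsubseteq>\<^bsub>M\<^esub> f y \<longleftrightarrow> x \<sqsubseteq>\<^bsub>L\<^esub> y"
    using assms(2) by (auto simp: order_iso_def)
  have im: "carrier M = f ` carrier L" using bij by (simp add: bij_betw_def)
  have fc: "f x \<in> carrier M" if "x \<in> carrier L" for x using im that by simp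
  interpret M: partial_order M
  proof
    show "x \<sqsubseteq>\<^bsub>M\<^esub> z" if "x \<sqsubseteq>\<^bsub>M\<^esub> y" "y \<sqsubseteq>\<^bsub>M\<^esub> z"
      "x \<in> carrier M" "y \<in> carrier M" "z \<in> carrier M" for x y z
      using that unfolding im by (auto simp: le intro: L.le_trans)
  qed (auto simp: assms(3) im le dest: L.le_antisym)
  have lub: "least M (f (x \<squnion>\<^bsub>L\<^esub> y)) (Upper M {f x, f y})"
    if c: "x \<in> carrier L" "y \<in> carrier L" for x y
    unfolding least_def Upper_def
    using c L.join_left[OF c] L.join_right[OF c] L.join_le[OF _ _ c]
    by (auto simp: im le)
  have glb: "greatest M (f (x \<sqinter>\<^bsub>L\<^esub> y)) (Lower M {f x, f y})"
    if c: "x \<in> carrier L" "y \<in> carrier L" for x y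
    unfolding greatest_def Lower_def
    using c L.meet_left[OF c] L.meet_right[OF c] L.meet_le[OF _ _ c]
    by (auto simp: im le)
  have latM: "lattice M"
  proof
    fix i j assume "i \<in> carrier M" "j \<in> carrier M"
    then obtain x y where "x \<in> carrier L" "y \<in> carrier L" "i = f x" "j = f y" by (auto simp: im)
    then show "\<exists>s. least M s (Upper M {i, j})" "\<exists>s. greatest M s (Lower M {i, j})"
      using lub[of x y] glb[of x y] by blast+
  qed
  have "f (x \<squnion>\<^bsub>L\<^esub> y) = f x \<squnion>\<^bsub>M\<^esub> f y" if "x \<in> carrier L" "y \<in> carrier L" for x y
    using M.least_unique[OF lub[OF that] someI[of "\<lambda>s. least M s (Upper M {f x, f y})", OF lub[OF that]]]
    by (simp only: join_def[of M] sup_def[of M])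
  moreover have "f (x \<sqinter>\<^bsub>L\<^esub> y) = f x \<sqinter>\<^bsub>M\<^esub> f y" if "x \<in> carrier L" "y \<in> carrier L" for x y
    using M.greatest_unique[OF glb[OF that] someI[of "\<lambda>s. greatest M s (Lower M {f x, f y})", OF glb[OF that]]]
    by (simp only: meet_def[of M] inf_def[of M])
  ultimately show ?thesis
    unfolding lattice_iso_def join_pres_def meet_pres_def using assms(1) latM bij by blast
qed

section \<open>Tops, bottoms and gluing at a cut point\<close>

lemma partial_order_subposet:
  assumes "partial_order L" "X \<subseteq> carrier L"
  shows "partial_order (subposet L X)"
proof -
  interpret partial_order L by (rule assms(1))
  show ?thesis
    by unfold_locales
      (use assms(2) in \<open>auto simp: subposet_def eq_is_equal intro: le_antisym le_trans\<close>)
qed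

lemma subposet_simps [simp]:
  "carrier (subposet P X) = X" "le (subposet P X) = le P" "eq (subposet P X) = eq P"
  by (simp_all add: subposet_def)

lemma subposet_subposet [simp]: "subposet (subposet P X) Y = subposet P Y"
  by (simp add: subposet_def)

lemma ordinal_sum_simps [simp]:
  "carrier (ordinal_sum P Q) = carrier P <+> carrier Q"
  "eq (ordinal_sum P Q) = (=)"
  "Inl a \<sqsubseteq>\<^bsub>ordinal_sum P Q\<^esub> Inl a' \<longleftrightarrow> a \<sqsubseteq>\<^bsub>P\<^esub> a'"
  "Inl a \<sqsubseteq>\<^bsub>ordinal_sum P Q\<^esub> Inr b"
  "\<not> Inr b \<sqsubseteq>\<^bsub>ordinal_sum P Q\<^esub> Inl a"
  "Inr b \<sqsubseteq>\<^bsub>ordinal_sum P Q\<^esub> Inr b' \<longleftrightarrow> b \<sqsubseteq>\<^bsub>Q\<^esub> b'"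
  by (simp_all add: ordinal_sum_def)

lemma singleton_poset_simps [simp]:
  "carrier singleton_poset = UNIV" "x \<sqsubseteq>\<^bsub>singleton_poset\<^esub> y"
  by (simp_all add: singleton_poset_def)

text \<open>\<open>\<top>\<close> is a value of the choice operator. Uniqueness is supplied by the
  second assumption instead of antisymmetry, so the lemma applies to a glued sum whose order laws
  have not been established.\<close>

lemma top_eqI:
  assumes "greatest P t (carrier P)"
    and "\<And>x. x \<in> carrier P \<Longrightarrow> t \<sqsubseteq>\<^bsub>P\<^esub> x \<Longrightarrow> x = t"
  shows "\<top>\<^bsub>P\<^esub> = t"
  unfolding top_def
  by (rule some_equality) (use assms in \<open>auto simp: greatest_def\<close>)

lemma bottom_eqI:
  assumes "least P t (carrier P)"
    and "\<And>x. x \<in> carrier P \<Longrightarrow> x \<sqsubseteq>\<^bsub>P\<^esub> t \<Longrightarrow> x = t"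
  shows "\<bottom>\<^bsub>P\<^esub> = t"
  unfolding bottom_def
  by (rule some_equality) (use assms in \<open>auto simp: least_def\<close>)

lemma order_iso_top:
  assumes "partial_order P" "order_iso P Q f" "greatest P t (carrier P)"
  shows "\<top>\<^bsub>Q\<^esub> = f t"
proof (rule top_eqI)
  interpret partial_order P by (rule assms(1))
  have im: "carrier Q = f ` carrier P"
    and le: "\<And>x y. x \<in> carrier P \<Longrightarrow> y \<in> carrier P \<Longrightarrow> f x \<sqsubseteq>\<^bsub>Q\<^esub> f y \<longleftrightarrow> x \<sqsubseteq>\<^bsub>P\<^esub> y"
    using assms(2) by (auto simp: order_iso_def bij_betw_def)
  have t: "t \<in> carrier P" "\<And>x. x \<in> carrier P \<Longrightarrow> x \<sqsubseteq>\<^bsub>P\<^esub> t" using assms(3) by (auto simp: greatest_def)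
  show "greatest Q (f t) (carrier Q)" using t by (auto simp: greatest_def im le)
  show "x = f t" if "x \<in> carrier Q" "f t \<sqsubseteq>\<^bsub>Q\<^esub> x" for x
  proof -
    obtain y where "y \<in> carrier P" "x = f y" using \<open>x \<in> carrier Q\<close> im by blast
    then show "x = f t" using that(2) t le_antisym[of y t] by (simp add: le)
  qed
qed

lemma order_iso_bottom:
  assumes "partial_order P" "order_iso P Q f" "least P t (carrier P)"
  shows "\<bottom>\<^bsub>Q\<^esub> = f t"
proof (rule bottom_eqI)
  interpret partial_order P by (rule assms(1))
  have im: "carrier Q = f ` carrier P"
    and le: "\<And>x y. x \<in> carrier P \<Longrightarrow> y \<in> carrier P \<Longrightarrow> f x \<sqsubseteq>\<^bsub>Q\<^esub> f y \<longleftrightarrow> x \<sqsubseteq>\<^bsub>P\<^esub> y"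
    using assms(2) by (auto simp: order_iso_def bij_betw_def)
  have t: "t \<in> carrier P" "\<And>x. x \<in> carrier P \<Longrightarrow> t \<sqsubseteq>\<^bsub>P\<^esub> x" using assms(3) by (auto simp: least_def)
  show "least Q (f t) (carrier Q)" using t by (auto simp: least_def im le)
  show "x = f t" if "x \<in> carrier Q" "x \<sqsubseteq>\<^bsub>Q\<^esub> f t" for x
  proof -
    obtain y where "y \<in> carrier P" "x = f y" using \<open>x \<in> carrier Q\<close> im by blast
    then show "x = f t" using that(2) t le_antisym[of y t] by (simp add: le)
  qed
qed

text \<open>An element \<open>p\<close> comparable with everything cuts \<open>L\<close> into a
  down-set and an up-set meeting only in \<open>p\<close>. The top of \<open>K\<close> and the
  bottom of \<open>M\<close> are the images of \<open>p\<close>, and the singleton replaces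
  both.\<close>

lemma order_iso_glued_sum:
  fixes L :: "'a gorder" (structure)
  assumes L: "partial_order L"
    and p: "p \<in> carrier L" "\<And>x. x \<in> carrier L \<Longrightarrow> x \<sqsubseteq> p \<or> p \<sqsubseteq> x"
    and f: "order_iso (subposet L {x \<in> carrier L. x \<sqsubseteq> p}) K f"
    and g: "order_iso (subposet L {x \<in> carrier L. p \<sqsubseteq> x}) M g"
  obtains h where "order_iso L (K +\<^sub>g\<^sub>l\<^sub>u M) h"
proof -
  interpret partial_order L by (rule L)
  \<comment> \<open>The test for \<open>p\<close> comes first, since
    \<open>p \<sqsubseteq> p\<close> would otherwise send it into the lower summand.\<close>
  define h where "h x = (if x = p then Inl (Inr ()) else if x \<sqsubseteq> p then Inl (Inl (f x)) else Inr (g x))" for x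
  have topK: "\<top>\<^bsub>K\<^esub> = f p"
    by (rule order_iso_top[OF partial_order_subposet[OF L] f]) (use p in \<open>auto simp: greatest_def\<close>)
  have botM: "\<bottom>\<^bsub>M\<^esub> = g p"
    by (rule order_iso_bottom[OF partial_order_subposet[OF L] g]) (use p in \<open>auto simp: least_def\<close>)
  have fim: "carrier K = f ` {x \<in> carrier L. x \<sqsubseteq> p}" and finj: "inj_on f {x \<in> carrier L. x \<sqsubseteq> p}"
    and gim: "carrier M = g ` {x \<in> carrier L. p \<sqsubseteq> x}" and ginj: "inj_on g {x \<in> carrier L. p \<sqsubseteq> x}"
    and fle: "\<And>x y. x \<in> carrier L \<Longrightarrow> x \<sqsubseteq> p \<Longrightarrow> y \<in> carrier L \<Longrightarrow> y \<sqsubseteq> p \<Longrightarrow> f x \<sqsubseteq>\<^bsub>K\<^esub> f y \<longleftrightarrow> x \<sqsubseteq> y"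
    and gle: "\<And>x y. x \<in> carrier L \<Longrightarrow> p \<sqsubseteq> x \<Longrightarrow> y \<in> carrier L \<Longrightarrow> p \<sqsubseteq> y \<Longrightarrow> g x \<sqsubseteq>\<^bsub>M\<^esub> g y \<longleftrightarrow> x \<sqsubseteq> y"
    using f g by (auto simp: order_iso_def bij_betw_def)
  have low: "carrier K - {f p} = f ` {x \<in> carrier L. x \<sqsubseteq> p \<and> x \<noteq> p}"
    using finj p(1) unfolding fim inj_on_def by auto
  have "{x \<in> carrier L. p \<sqsubseteq> x} - {p} = {x \<in> carrier L. \<not> x \<sqsubseteq> p}"
    using p le_antisym by blast
  then have up: "carrier M - {g p} = g ` {x \<in> carrier L. \<not> x \<sqsubseteq> p}"
    using inj_on_image_set_diff[OF ginj, of "{x \<in> carrier L. p \<sqsubseteq> x}" "{p}"] p(1)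
    by (auto simp: gim)
  have "order_iso L (K +\<^sub>g\<^sub>l\<^sub>u M) h"
  proof (rule order_isoI)
    show "partial_order L" by (rule L)
    have "carrier L = {x \<in> carrier L. x \<sqsubseteq> p \<and> x \<noteq> p} \<union> {p} \<union> {x \<in> carrier L. \<not> x \<sqsubseteq> p}"
      using p by auto
    then have "h ` carrier L = h ` ({x \<in> carrier L. x \<sqsubseteq> p \<and> x \<noteq> p} \<union> {p} \<union> {x \<in> carrier L. \<not> x \<sqsubseteq> p})"
      by (rule arg_cong)
    also have "\<dots> = h ` {x \<in> carrier L. x \<sqsubseteq> p \<and> x \<noteq> p} \<union> {h p} \<union> h ` {x \<in> carrier L. \<not> x \<sqsubseteq> p}"
      by (simp only: image_Un image_insert image_empty)
    also have "\<dots> = (Inl ` Inl ` (carrier K - {f p})) \<union> {Inl (Inr ())} \<union> Inr ` (carrier M - {g p})"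
      unfolding low up using p(1) by (auto simp: h_def image_iff)
    also have "\<dots> = carrier (K +\<^sub>g\<^sub>l\<^sub>u M)"
      by (auto simp: glued_sum_def topK botM)
    finally show "h ` carrier L = carrier (K +\<^sub>g\<^sub>l\<^sub>u M)" .
    fix x y assume c: "x \<in> carrier L" "y \<in> carrier L"
    \<comment> \<open>Comparisons across the cut go through \<open>p\<close>; these facts settle the
      cases with \<open>x\<close> and \<open>y\<close> on different sides.\<close>
    have tr: "x \<sqsubseteq> y" if "x \<sqsubseteq> p" "p \<sqsubseteq> y" using le_trans[OF that c(1) p(1) c(2)] .
    have tr2: "x \<sqsubseteq> p" if "x \<sqsubseteq> y" "y \<sqsubseteq> p" using le_trans[OF that c p(1)] .
    have an: "x = p" if "x \<sqsubseteq> p" "p \<sqsubseteq> x" using le_antisym[OF that c(1) p(1)] .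
    have an2: "y = p" if "y \<sqsubseteq> p" "p \<sqsubseteq> y" using le_antisym[OF that c(2) p(1)] .
    show "h x \<sqsubseteq>\<^bsub>K +\<^sub>g\<^sub>l\<^sub>u M\<^esub> h y \<longleftrightarrow> x \<sqsubseteq> y"
      using tr tr2 an an2 p(2)[OF c(1)] p(2)[OF c(2)] c p(1) fle[OF c(1) _ c(2)] gle[OF c(1) _ c(2)]
      by (cases "x = p"; cases "y = p"; cases "x \<sqsubseteq> p"; cases "y \<sqsubseteq> p")
        (simp_all add: h_def glued_sum_def, blast+)
  qed
  then show thesis by (rule that)
qed

text \<open>The rank of \<open>x\<close>, the number of elements below it, is strictly increasing on
  a chain. The chains have to be moved to \<open>nat\<close> because the final statement quantifies
  over chains of that type.\<close>

lemma chain_order_iso_nat: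
  fixes P :: "'a gorder" (structure)
  assumes "finite_chain P"
  obtains C :: "nat gorder" and f where "finite_chain C" "order_iso P C f"
proof -
  interpret total_order P using assms by (simp add: finite_chain_def)
  have fin: "finite (carrier P)" and ne: "carrier P \<noteq> {}" using assms by (auto simp: finite_chain_def)
  define f where "f x = card {y \<in> carrier P. y \<sqsubseteq> x}" for x
  define C :: "nat gorder" where "C = \<lparr>carrier = f ` carrier P, eq = (=), le = (\<le>)\<rparr>"
  have mono: "f x \<le> f y" if "x \<in> carrier P" "y \<in> carrier P" "x \<sqsubseteq> y" for x y
    unfolding f_def by (rule card_mono) (use that fin in \<open>auto intro: le_trans\<close>)
  have strict: "f y < f x" if "x \<in> carrier P" "y \<in> carrier P" "\<not> x \<sqsubseteq> y" for x y
    unfolding f_def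
  proof (rule psubset_card_mono)
    have "y \<sqsubseteq> x" using total_order_total that by blast
    then have "{z \<in> carrier P. z \<sqsubseteq> y} \<subseteq> {z \<in> carrier P. z \<sqsubseteq> x}"
      using that le_trans by blast
    moreover have "x \<in> {z \<in> carrier P. z \<sqsubseteq> x}" "x \<notin> {z \<in> carrier P. z \<sqsubseteq> y}"
      using that by auto
    ultimately show "{z \<in> carrier P. z \<sqsubseteq> y} \<subset> {z \<in> carrier P. z \<sqsubseteq> x}" by blast
  qed (use fin in simp)
  have "f x \<le> f y \<longleftrightarrow> x \<sqsubseteq> y" if "x \<in> carrier P" "y \<in> carrier P" for x y
    using mono[OF that] strict[OF that] by linarith
  then have "order_iso P C f"
    using order_isoI[of P f C] partial_order_axioms by (simp add: C_def)
  moreover have "total_order C" by unfold_locales (auto simp: C_def)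
  then have "finite_chain C" using fin ne by (simp add: finite_chain_def C_def)
  ultimately show thesis using that by blast
qed

lemma glued_decomposition:
  fixes L :: "'a gorder" (structure) and B :: "'b gorder"
  assumes L: "finite_lattice L" and mj: "m \<in> carrier L" "j \<in> carrier L" "m \<sqsubseteq> j"
    and cover: "\<And>x. x \<in> carrier L \<Longrightarrow> x \<sqsubseteq> m \<or> m \<sqsubseteq> x \<and> x \<sqsubseteq> j \<or> j \<sqsubseteq> x"
    and low: "\<And>x y. incomp L x y \<Longrightarrow> \<not> (x \<sqsubseteq> m \<and> y \<sqsubseteq> m)"
    and high: "\<And>x y. incomp L x y \<Longrightarrow> \<not> (j \<sqsubseteq> x \<and> j \<sqsubseteq> y)"
    and u: "order_iso (subposet L {x \<in> carrier L. m \<sqsubseteq> x \<and> x \<sqsubseteq> j}) B u"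
  obtains C\<^sub>1 C\<^sub>2 :: "nat gorder" where "finite_chain C\<^sub>1" "finite_chain C\<^sub>2"
    "lattice_iso L (C\<^sub>1 +\<^sub>g\<^sub>l\<^sub>u B +\<^sub>g\<^sub>l\<^sub>u C\<^sub>2)"
proof -
  interpret lattice L using L by (simp add: finite_lattice_def)
  have fin: "finite (carrier L)" using L by (simp add: finite_lattice_def)
  have chain: "finite_chain (subposet L X)"
    if "X \<subseteq> carrier L" "X \<noteq> {}" "\<And>x y. x \<in> X \<Longrightarrow> y \<in> X \<Longrightarrow> \<not> incomp L x y" for X
  proof -
    have "x \<sqsubseteq> y \<or> y \<sqsubseteq> x" if "x \<in> X" "y \<in> X" for x y
      using \<open>X \<subseteq> carrier L\<close> \<open>x \<in> X \<Longrightarrow> y \<in> X \<Longrightarrow> \<not> incomp L x y\<close> that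
      by (auto simp: incomp_def)
    then have "total_order (subposet L X)"
      using partial_order.total_orderI[OF partial_order_subposet[OF partial_order_axioms that(1)]]
      by simp
    then show ?thesis using that(1,2) fin by (simp add: finite_chain_def finite_subset)
  qed
  \<comment> \<open>Cutting first at \<open>j\<close> and then, inside \<open>D\<close>, at
    \<open>m\<close> matches the left association of the glued sum.\<close>
  define D where "D = subposet L {x \<in> carrier L. x \<sqsubseteq> j}"
  have D: "partial_order D"
    unfolding D_def by (rule partial_order_subposet[OF partial_order_axioms]) simp
  have "finite_chain (subposet L {x \<in> carrier L. x \<sqsubseteq> m})"
    by (rule chain) (use mj low in auto)
  then obtain C\<^sub>1 :: "nat gorder" and f
    where C1: "finite_chain C\<^sub>1" and f: "order_iso (subposet L {x \<in> carrier L. x \<sqsubseteq> m}) C\<^sub>1 f"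
    by (rule chain_order_iso_nat)
  have "finite_chain (subposet L {x \<in> carrier L. j \<sqsubseteq> x})"
    by (rule chain) (use mj high in auto)
  then obtain C\<^sub>2 :: "nat gorder" and g
    where C2: "finite_chain C\<^sub>2" and g: "order_iso (subposet L {x \<in> carrier L. j \<sqsubseteq> x}) C\<^sub>2 g"
    by (rule chain_order_iso_nat)
  have "{x \<in> carrier D. x \<sqsubseteq>\<^bsub>D\<^esub> m} = {x \<in> carrier L. x \<sqsubseteq> m}"
    using mj le_trans by (auto simp: D_def)
  then have f': "order_iso (subposet D {x \<in> carrier D. x \<sqsubseteq>\<^bsub>D\<^esub> m}) C\<^sub>1 f"
    using f by (simp add: D_def)
  have "{x \<in> carrier D. m \<sqsubseteq>\<^bsub>D\<^esub> x} = {x \<in> carrier L. m \<sqsubseteq> x \<and> x \<sqsubseteq> j}"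
    by (auto simp: D_def)
  then have u': "order_iso (subposet D {x \<in> carrier D. m \<sqsubseteq>\<^bsub>D\<^esub> x}) B u"
    using u by (simp add: D_def)
  have md: "m \<in> carrier D" using mj by (simp add: D_def)
  have "x \<sqsubseteq>\<^bsub>D\<^esub> m \<or> m \<sqsubseteq>\<^bsub>D\<^esub> x" if "x \<in> carrier D" for x
    using cover[of x] that mj le_trans by (auto simp: D_def)
  then obtain h where "order_iso D (C\<^sub>1 +\<^sub>g\<^sub>l\<^sub>u B) h"
    using order_iso_glued_sum[OF D md _ f' u'] by blast
  moreover have "x \<sqsubseteq> j \<or> j \<sqsubseteq> x" if "x \<in> carrier L" for x
    using cover[OF that] that mj le_trans by blast
  ultimately obtain k where k: "order_iso L (C\<^sub>1 +\<^sub>g\<^sub>l\<^sub>u B +\<^sub>g\<^sub>l\<^sub>u C\<^sub>2) k"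
    using order_iso_glued_sum[OF partial_order_axioms mj(2) _ _ g] unfolding D_def by blast
  have "lattice_iso L (C\<^sub>1 +\<^sub>g\<^sub>l\<^sub>u B +\<^sub>g\<^sub>l\<^sub>u C\<^sub>2)"
    by (rule order_iso_imp_lattice_iso[OF lattice_axioms k]) (simp add: glued_sum_def)
  then show thesis using that C1 C2 by blast
qed

section \<open>From incomparable pairs to the glued sum\<close>

context fin_lattice
begin

text \<open>The pair \<open>x, b\<close> does not contain \<open>a\<close>, so \<open>x\<close> is
  comparable with \<open>b\<close>. If \<open>x \<sqsubseteq> a\<close>, then
  \<open>b \<sqsubseteq> x\<close> would give \<open>b \<sqsubseteq> a\<close>; hence
  \<open>x\<close> lies below both and thus below the meet. The other case is dual.\<close>

lemma incomp_interval:
  assumes ab: "incomp L a b" and only: "\<And>x y. incomp L x y \<Longrightarrow> a = x \<or> a = y"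
    and same: "\<And>x. incomp L a x \<Longrightarrow> a \<squnion> x = a \<squnion> b \<and> a \<sqinter> x = a \<sqinter> b"
    and x: "x \<in> carrier L" "x \<noteq> a" "\<not> incomp L a x"
  shows "x \<sqsubseteq> a \<sqinter> b \<or> a \<squnion> b \<sqsubseteq> x"
proof -
  have c: "a \<in> carrier L" "b \<in> carrier L" "\<not> a \<sqsubseteq> b" "\<not> b \<sqsubseteq> a" using ab by (auto simp: incomp_def)
  have "x \<sqsubseteq> a \<or> a \<sqsubseteq> x" using x c by (auto simp: incomp_def)
  moreover have xb: "x \<sqsubseteq> b \<or> b \<sqsubseteq> x" using only[of x b] x c incomp_join_meet(3)[OF ab] by (auto simp: incomp_def)
  moreover have "x \<sqsubseteq> b" if "x \<sqsubseteq> a" using xb le_trans[of b x a] c x that by blast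
  moreover have "b \<sqsubseteq> x" if "a \<sqsubseteq> x" using xb le_trans[of a x b] c x that by blast
  ultimately show ?thesis using meet_le[of x a b] join_le[of a x b] x c by blast
qed

text \<open>The common core of the two shapes: the interval from meet to join consists of its ends,
  \<open>a\<close>, and everything incomparable with \<open>a\<close>, so only the isomorphism type
  of this small interval remains to be identified.\<close>

lemma incomp_decomposition:
  fixes B :: "'b gorder"
  assumes ab: "incomp L a b" and only: "\<And>x y. incomp L x y \<Longrightarrow> a = x \<or> a = y"
    and same: "\<And>x. incomp L a x \<Longrightarrow> a \<squnion> x = a \<squnion> b \<and> a \<sqinter> x = a \<sqinter> b"
    and u: "order_iso (subposet L ({a \<sqinter> b, a, a \<squnion> b} \<union> {x. incomp L a x})) B u"
  obtains C\<^sub>1 C\<^sub>2 :: "nat gorder" where "finite_chain C\<^sub>1" "finite_chain C\<^sub>2"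
    "lattice_iso L (C\<^sub>1 +\<^sub>g\<^sub>l\<^sub>u B +\<^sub>g\<^sub>l\<^sub>u C\<^sub>2)"
proof -
  note jm = incomp_join_meet[OF ab]
  have le: "a \<sqinter> b \<sqsubseteq> a" "a \<sqsubseteq> a \<squnion> b" "a \<sqinter> b \<sqsubseteq> a \<squnion> b"
    using jm join_left[of a b] meet_left[of a b] le_trans[of "a \<sqinter> b" a "a \<squnion> b"] by auto
  have x: "x \<in> carrier L" "a \<sqinter> b \<sqsubseteq> x" "x \<sqsubseteq> a \<squnion> b" if "incomp L a x" for x
    using same[OF that] incomp_join_meet(1,2)[OF that] join_right[of a x] meet_right[of a x] by auto
  have int: "y \<sqsubseteq> a \<sqinter> b \<or> a \<squnion> b \<sqsubseteq> y" if "y \<in> carrier L" "y \<noteq> a" "\<not> incomp L a y" for y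
    by (rule incomp_interval[OF ab _ _ that]) (use only same in blast)+
  have mid: "incomp L a y"
    if "y \<in> carrier L" "a \<sqinter> b \<sqsubseteq> y" "y \<sqsubseteq> a \<squnion> b" "y \<noteq> a" "y \<noteq> a \<sqinter> b" "y \<noteq> a \<squnion> b" for y
    using int[of y] le_antisym[of y "a \<sqinter> b"] le_antisym[of y "a \<squnion> b"] that jm by blast
  have "{x \<in> carrier L. a \<sqinter> b \<sqsubseteq> x \<and> x \<sqsubseteq> a \<squnion> b} = {a \<sqinter> b, a, a \<squnion> b} \<union> {x. incomp L a x}"
  proof
    show "{x \<in> carrier L. a \<sqinter> b \<sqsubseteq> x \<and> x \<sqsubseteq> a \<squnion> b} \<subseteq> {a \<sqinter> b, a, a \<squnion> b} \<union> {x. incomp L a x}"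
      using mid by blast
    show "{a \<sqinter> b, a, a \<squnion> b} \<union> {x. incomp L a x} \<subseteq> {x \<in> carrier L. a \<sqinter> b \<sqsubseteq> x \<and> x \<sqsubseteq> a \<squnion> b}"
      using x le jm(1,4,5) le_refl by blast
  qed
  then have u': "order_iso (subposet L {x \<in> carrier L. a \<sqinter> b \<sqsubseteq> x \<and> x \<sqsubseteq> a \<squnion> b}) B u"
    using u by simp
  \<comment> \<open>Every incomparable pair contains \<open>a\<close>, which is neither below the
    meet nor above the join; hence the parts outside the interval are chains.\<close>
  have na: "\<not> a \<sqsubseteq> a \<sqinter> b" "\<not> a \<squnion> b \<sqsubseteq> a"
    using le_antisym[of a "a \<sqinter> b"] le_antisym[of a "a \<squnion> b"] le jm by auto
  show thesis
  proof (rule glued_decomposition[OF _ jm(5,4) le(3) _ _ _ u'])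
    show "finite_lattice L" using lattice_axioms fin jm(1) by (auto simp: finite_lattice_def)
    show "y \<sqsubseteq> a \<sqinter> b \<or> a \<sqinter> b \<sqsubseteq> y \<and> y \<sqsubseteq> a \<squnion> b \<or> a \<squnion> b \<sqsubseteq> y" if "y \<in> carrier L" for y
      using int[OF that] x[of y] le by blast
    show "\<not> (y \<sqsubseteq> a \<sqinter> b \<and> z \<sqsubseteq> a \<sqinter> b)" if "incomp L y z" for y z
      using only[OF that] na by blast
    show "\<not> (a \<squnion> b \<sqsubseteq> y \<and> a \<squnion> b \<sqsubseteq> z)" if "incomp L y z" for y z
      using only[OF that] na by blast
  qed (rule that)
qed

lemma incomp_pairs_B4_iso:
  assumes "incomp_pairs L = {{a, b}}"
  obtains C\<^sub>1 C\<^sub>2 :: "nat gorder" where "finite_chain C\<^sub>1" "finite_chain C\<^sub>2"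
    "lattice_iso L (C\<^sub>1 +\<^sub>g\<^sub>l\<^sub>u B4 +\<^sub>g\<^sub>l\<^sub>u C\<^sub>2)"
proof -
  have iff: "incomp L x y \<longleftrightarrow> {x, y} = {a, b}" for x y
    using assms mem_incomp_pairs[of x y L] by simp
  have ab: "incomp L a b" by (simp add: iff)
  note jm = incomp_join_meet[OF ab]
  have inc: "incomp L a x \<longleftrightarrow> x = b" for x using jm by (auto simp: iff doubleton_eq_iff)
  have only: "a = x \<or> a = y" if "incomp L x y" for x y using that by (auto simp: iff doubleton_eq_iff)
  define u where "u x = (if x = a then B4_a else if x = b then B4_b
    else if x = a \<sqinter> b then B4_0 else B4_1)" for x
  have le: "a \<sqinter> b \<sqsubseteq> a" "a \<sqinter> b \<sqsubseteq> b" "a \<sqsubseteq> a \<squnion> b" "b \<sqsubseteq> a \<squnion> b" "a \<sqinter> b \<sqsubseteq> a \<squnion> b"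
    using jm join_left[of a b] meet_left[of a b] join_right[of a b] meet_right[of a b]
      le_trans[of "a \<sqinter> b" a "a \<squnion> b"] by auto
  have nle: "\<not> a \<sqsubseteq> a \<sqinter> b" "\<not> b \<sqsubseteq> a \<sqinter> b" "\<not> a \<squnion> b \<sqsubseteq> a" "\<not> a \<squnion> b \<sqsubseteq> b" "\<not> a \<squnion> b \<sqsubseteq> a \<sqinter> b"
    "\<not> a \<sqsubseteq> b" "\<not> b \<sqsubseteq> a"
    using le jm le_antisym[of a "a \<sqinter> b"] le_antisym[of b "a \<sqinter> b"] le_antisym[of "a \<squnion> b" a]
      le_antisym[of "a \<squnion> b" b] le_antisym[of "a \<squnion> b" "a \<sqinter> b"] ab
    by (auto simp: incomp_def)
  have u: "order_iso (subposet L ({a \<sqinter> b, a, a \<squnion> b} \<union> {x. incomp L a x})) B4 u"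
  proof (rule order_isoI)
    show "partial_order (subposet L ({a \<sqinter> b, a, a \<squnion> b} \<union> {x. incomp L a x}))"
      by (rule partial_order_subposet[OF partial_order_axioms]) (use jm inc in auto)
    have "z \<in> {B4_0, B4_a, B4_1, B4_b}" for z by (cases z) auto
    then show "u ` carrier (subposet L ({a \<sqinter> b, a, a \<squnion> b} \<union> {x. incomp L a x})) = carrier B4"
      using jm by (auto simp: inc B4_def u_def)
  qed (use jm le nle in \<open>auto simp: inc B4_def u_def\<close>)
  have same: "a \<squnion> x = a \<squnion> b \<and> a \<sqinter> x = a \<sqinter> b" if "incomp L a x" for x
    using that inc by simp
  show thesis
    by (rule incomp_decomposition[OF ab _ _ u]) (use only same that in blast)+
qed

lemma incomp_pairs_N5_iso:
  assumes pairs: "incomp_pairs L = {{a, b}, {a, c}}" and "b \<noteq> c"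
  obtains C\<^sub>1 C\<^sub>2 :: "nat gorder" where "finite_chain C\<^sub>1" "finite_chain C\<^sub>2"
    "lattice_iso L (C\<^sub>1 +\<^sub>g\<^sub>l\<^sub>u N5 +\<^sub>g\<^sub>l\<^sub>u C\<^sub>2)"
proof -
  note result = that
  \<comment> \<open>The hypothesis is symmetric in \<open>b\<close> and \<open>c\<close>, so the
    case \<open>b \<sqsubseteq> c\<close> suffices.\<close>
  have *: thesis if pairs: "incomp_pairs L = {{a, b}, {a, c}}" and bc: "b \<noteq> c" "b \<sqsubseteq> c" for b c
  proof -
    note abc = incomp_pairs_two[OF pairs bc(1)]
    have iff: "incomp L x y \<longleftrightarrow> {x, y} = {a, b} \<or> {x, y} = {a, c}" for x y
      using pairs mem_incomp_pairs[of x y L] by simp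
    note jm = incomp_join_meet[OF abc(1)] incomp_join_meet[OF abc(2), folded abc(3,4)]
    have inc: "incomp L a x \<longleftrightarrow> x = b \<or> x = c" for x using jm by (auto simp: iff doubleton_eq_iff)
    have only: "a = x \<or> a = y" if "incomp L x y" for x y using that by (auto simp: iff doubleton_eq_iff)
    \<comment> \<open>The element \<open>a\<close> common to both pairs plays the lone side
      \<open>N5_b\<close>; \<open>b\<close> and \<open>c\<close> form the two-element side. The last
      branch is reached only by the join.\<close>
    define u where "u x = (if x = a then N5_b else if x = b then N5_a else if x = c then N5_c
      else if x = a \<sqinter> b then N5_0 else N5_1)" for x
    have le: "a \<sqinter> b \<sqsubseteq> a" "a \<sqinter> b \<sqsubseteq> b" "a \<sqinter> b \<sqsubseteq> c" "a \<sqsubseteq> a \<squnion> b" "b \<sqsubseteq> a \<squnion> b" "c \<sqsubseteq> a \<squnion> b"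
      "a \<sqinter> b \<sqsubseteq> a \<squnion> b"
      using jm join_left[of a b] meet_left[of a b] join_right[of a b] meet_right[of a b]
        join_right[of a c] meet_right[of a c]
        le_trans[of "a \<sqinter> b" a "a \<squnion> b"] abc(3,4) by auto
    have nle: "\<not> a \<sqsubseteq> a \<sqinter> b" "\<not> b \<sqsubseteq> a \<sqinter> b" "\<not> c \<sqsubseteq> a \<sqinter> b" "\<not> a \<squnion> b \<sqsubseteq> a" "\<not> a \<squnion> b \<sqsubseteq> b"
      "\<not> a \<squnion> b \<sqsubseteq> c" "\<not> a \<squnion> b \<sqsubseteq> a \<sqinter> b" "\<not> a \<sqsubseteq> b" "\<not> b \<sqsubseteq> a" "\<not> a \<sqsubseteq> c" "\<not> c \<sqsubseteq> a" "\<not> c \<sqsubseteq> b"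
      using le jm le_antisym[of a "a \<sqinter> b"] le_antisym[of b "a \<sqinter> b"] le_antisym[of c "a \<sqinter> b"]
        le_antisym[of "a \<squnion> b" a] le_antisym[of "a \<squnion> b" b] le_antisym[of "a \<squnion> b" c]
        le_antisym[of "a \<squnion> b" "a \<sqinter> b"] le_antisym[of b c] abc(1,2) bc
      by (auto simp: incomp_def)
    have u: "order_iso (subposet L ({a \<sqinter> b, a, a \<squnion> b} \<union> {x. incomp L a x})) N5 u"
    proof (rule order_isoI)
      show "partial_order (subposet L ({a \<sqinter> b, a, a \<squnion> b} \<union> {x. incomp L a x}))"
        by (rule partial_order_subposet[OF partial_order_axioms]) (use jm inc in auto)
      have "z \<in> {N5_0, N5_a, N5_b, N5_c, N5_1}" for z by (cases z) auto
      then show "u ` carrier (subposet L ({a \<sqinter> b, a, a \<squnion> b} \<union> {x. incomp L a x})) = carrier N5"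
        using jm bc by (auto simp: inc N5_def u_def)
    qed (use jm le nle bc in \<open>auto simp: inc N5_def u_def\<close>)
    have same: "a \<squnion> x = a \<squnion> b \<and> a \<sqinter> x = a \<sqinter> b" if "incomp L a x" for x
      using that inc abc(3,4) by auto
    show thesis
      by (rule incomp_decomposition[OF abc(1) _ _ u]) (use only same result in blast)+
  qed
  note abc = incomp_pairs_two[OF assms]
  have "b \<sqsubseteq> c \<or> c \<sqsubseteq> b" using abc by (auto simp: incomp_def)
  moreover have "incomp_pairs L = {{a, c}, {a, b}}" using pairs by (simp add: insert_commute)
  ultimately show thesis using *[OF pairs] *[of c b] \<open>b \<noteq> c\<close> by blast
qed

end

subsection \<open>Incomparable pairs of glued sums\<close>

text \<open>Elements of different summands are always comparable, and so is the glued point with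
  everything; an incomparable pair therefore lies inside one summand, away from the deleted
  end.\<close>

lemma incomp_glued_sum:
  "incomp (K +\<^sub>g\<^sub>l\<^sub>u M) x y \<longleftrightarrow>
    (\<exists>k l. x = Inl (Inl k) \<and> y = Inl (Inl l) \<and> incomp K k l \<and> k \<noteq> \<top>\<^bsub>K\<^esub> \<and> l \<noteq> \<top>\<^bsub>K\<^esub>) \<or>
    (\<exists>k l. x = Inr k \<and> y = Inr l \<and> incomp M k l \<and> k \<noteq> \<bottom>\<^bsub>M\<^esub> \<and> l \<noteq> \<bottom>\<^bsub>M\<^esub>)"
  unfolding incomp_def glued_sum_def
  by (cases x rule: sum.exhaust; cases y rule: sum.exhaust;
      cases "projl x" rule: sum.exhaust; cases "projl y" rule: sum.exhaust) auto

lemma incomp_finite_chain: "finite_chain C \<Longrightarrow> \<not> incomp C x y"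
  unfolding finite_chain_def incomp_def using total_order.total_order_total[of C x y] by blast

lemma incomp_glued_chains:
  assumes C: "finite_chain C\<^sub>1" "finite_chain C\<^sub>2" and B: "partial_order B"
    and b: "least B b (carrier B)" and t: "greatest B t (carrier B)" and bt: "b \<noteq> t"
  shows "incomp (C\<^sub>1 +\<^sub>g\<^sub>l\<^sub>u B +\<^sub>g\<^sub>l\<^sub>u C\<^sub>2) x y \<longleftrightarrow>
    (\<exists>p q. x = Inl (Inl (Inr p)) \<and> y = Inl (Inl (Inr q)) \<and> incomp B p q)"
proof -
  interpret B: partial_order B by (rule B)
  have bB: "b \<in> carrier B" "\<And>x. x \<in> carrier B \<Longrightarrow> b \<sqsubseteq>\<^bsub>B\<^esub> x" using b by (auto simp: least_def)
  have tB: "t \<in> carrier B" "\<And>x. x \<in> carrier B \<Longrightarrow> x \<sqsubseteq>\<^bsub>B\<^esub> t" using t by (auto simp: greatest_def)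
  have bot: "\<bottom>\<^bsub>B\<^esub> = b"
    by (rule bottom_eqI[OF b]) (use bB B.le_antisym in blast)
  have t_max: "x = t" if "x \<in> carrier B" "t \<sqsubseteq>\<^bsub>B\<^esub> x" for x
    using that tB B.le_antisym by blast
  \<comment> \<open>By \<open>b \<noteq> t\<close> the top of \<open>B\<close> survives the deletion
    of its bottom, so it is the top of the inner sum rather than the glued point.\<close>
  have top: "\<top>\<^bsub>C\<^sub>1 +\<^sub>g\<^sub>l\<^sub>u B\<^esub> = Inr t"
  proof (rule top_eqI)
    show "greatest (C\<^sub>1 +\<^sub>g\<^sub>l\<^sub>u B) (Inr t) (carrier (C\<^sub>1 +\<^sub>g\<^sub>l\<^sub>u B))"
      using tB bt by (auto simp: greatest_def glued_sum_def bot)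
    show "x = Inr t" if "x \<in> carrier (C\<^sub>1 +\<^sub>g\<^sub>l\<^sub>u B)" "Inr t \<sqsubseteq>\<^bsub>C\<^sub>1 +\<^sub>g\<^sub>l\<^sub>u B\<^esub> x" for x
      using that t_max by (cases x) (auto simp: glued_sum_def)
  qed
  have ne: "p \<noteq> b \<and> p \<noteq> t \<and> q \<noteq> b \<and> q \<noteq> t" if "incomp B p q" for p q
    using that bB(2) tB(2) unfolding incomp_def by blast
  show ?thesis
    unfolding incomp_glued_sum[of "C\<^sub>1 +\<^sub>g\<^sub>l\<^sub>u B" C\<^sub>2] incomp_glued_sum[of C\<^sub>1 B] top bot
    using incomp_finite_chain[OF C(1)] incomp_finite_chain[OF C(2)] ne by auto
qed

lemma incomp_pairs_glued_chains:
  assumes "finite_chain C\<^sub>1" "finite_chain C\<^sub>2" "partial_order B"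
    and "least B b (carrier B)" "greatest B t (carrier B)" "b \<noteq> t"
  shows "incomp_pairs (C\<^sub>1 +\<^sub>g\<^sub>l\<^sub>u B +\<^sub>g\<^sub>l\<^sub>u C\<^sub>2) = (`) (\<lambda>p. Inl (Inl (Inr p))) ` incomp_pairs B"
  unfolding incomp_pairs_def incomp_glued_chains[OF assms] by (auto simp: image_iff) blast

lemma B4_props:
  "partial_order B4" "least B4 B4_0 (carrier B4)" "greatest B4 B4_1 (carrier B4)"
  "incomp_pairs B4 = {{B4_a, B4_b}}"
proof -
  show "partial_order B4" by unfold_locales (auto simp: B4_def)
  show "least B4 B4_0 (carrier B4)" "greatest B4 B4_1 (carrier B4)"
    by (auto simp: B4_def least_def greatest_def Upper_def Lower_def)
  have "incomp B4 x y \<longleftrightarrow> x = B4_a \<and> y = B4_b \<or> x = B4_b \<and> y = B4_a" for x y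
    by (cases x; cases y) (auto simp: incomp_def B4_def)
  then show "incomp_pairs B4 = {{B4_a, B4_b}}" by (auto simp: incomp_pairs_def)
qed

lemma N5_props:
  "partial_order N5" "least N5 N5_0 (carrier N5)" "greatest N5 N5_1 (carrier N5)"
  "incomp_pairs N5 = {{N5_b, N5_a}, {N5_b, N5_c}}"
proof -
  show "partial_order N5" by unfold_locales (auto simp: N5_def)
  show "least N5 N5_0 (carrier N5)" "greatest N5 N5_1 (carrier N5)"
    by (auto simp: N5_def least_def greatest_def Upper_def Lower_def)
  have "incomp N5 x y \<longleftrightarrow> x = N5_b \<and> y = N5_a \<or> x = N5_a \<and> y = N5_b \<or> x = N5_b \<and> y = N5_c
      \<or> x = N5_c \<and> y = N5_b" for x y
    by (cases x; cases y) (auto simp: incomp_def N5_def)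
  then show "incomp_pairs N5 = {{N5_b, N5_a}, {N5_b, N5_c}}" by (auto simp: incomp_pairs_def)
qed

section \<open>Matching counts with shapes\<close>

lemma lattice_iso_finite_lattice:
  assumes "finite_lattice L" "lattice_iso L M"
  shows "finite_lattice M" "card (carrier M) = card (carrier L)"
proof -
  obtain f where f: "bij_betw f (carrier L) (carrier M)" "lattice M"
    using assms(2) by (auto simp: lattice_iso_def join_pres_def)
  then show "card (carrier M) = card (carrier L)" by (simp add: bij_betw_same_card)
  show "finite_lattice M"
    using assms(1) f bij_betw_finite[OF f(1)] by (auto simp: finite_lattice_def bij_betw_def)
qed

lemma fin_lattice_iff: "finite_lattice L \<longleftrightarrow> fin_lattice L \<and> carrier L \<noteq> {}"
  by (auto simp: finite_lattice_def fin_lattice_def fin_lattice_axioms_def)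

lemma finite_chain_iff:
  assumes "finite_lattice L"
  shows "finite_chain L \<longleftrightarrow> incomp_pairs L = {}"
proof
  show "incomp_pairs L = {}" if "finite_chain L"
    using incomp_finite_chain[OF that] by (auto simp: incomp_pairs_def)
  assume *: "incomp_pairs L = {}"
  interpret lattice L using assms by (simp add: finite_lattice_def)
  have "total_order L"
    by (rule total_orderI) (use * in \<open>auto simp: incomp_pairs_def incomp_def\<close>)
  then show "finite_chain L" using assms by (simp add: finite_chain_def finite_lattice_def)
qed

text \<open>From count to shape, the value singles out one case of \<open>card_Sub_cases\<close>.
  From shape to count, the incomparable pairs of the glued sum fix its count, which the isomorphism
  carries back to \<open>L\<close>. The last claim is the gap statement needed for the
  ranking.\<close>

lemma card_Sub_iff:
  fixes L :: "'a gorder"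
  assumes L: "finite_lattice L" and n: "5 \<le> card (carrier L)"
  shows "card (Sub L) = 2 ^ card (carrier L) \<longleftrightarrow> finite_chain L"
    and "card (Sub L) = 26 * 2 ^ (card (carrier L) - 5) \<longleftrightarrow>
      (\<exists>(C\<^sub>1 :: nat gorder) (C\<^sub>2 :: nat gorder). finite_chain C\<^sub>1 \<and> finite_chain C\<^sub>2 \<and>
        lattice_iso L (C\<^sub>1 +\<^sub>g\<^sub>l\<^sub>u B4 +\<^sub>g\<^sub>l\<^sub>u C\<^sub>2))"
    and "card (Sub L) = 23 * 2 ^ (card (carrier L) - 5) \<longleftrightarrow>
      (\<exists>(C\<^sub>0 :: nat gorder) (C\<^sub>1 :: nat gorder). finite_chain C\<^sub>0 \<and> finite_chain C\<^sub>1 \<and>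
        lattice_iso L (C\<^sub>0 +\<^sub>g\<^sub>l\<^sub>u N5 +\<^sub>g\<^sub>l\<^sub>u C\<^sub>1))"
    and "card (Sub L) \<in> {2 ^ card (carrier L), 26 * 2 ^ (card (carrier L) - 5),
        23 * 2 ^ (card (carrier L) - 5)} \<or> card (Sub L) < 23 * 2 ^ (card (carrier L) - 5)"
proof -
  interpret fin_lattice L using L by (simp add: fin_lattice_iff)
  let ?n = "card (carrier L)"
  have pos: "0 < (2::nat) ^ (?n - 5)" by simp
  note p = power_card_carrier[OF n]
  have n4: "(2::nat) ^ (?n - 4) = 2 * 2 ^ (?n - 5)"
  proof -
    have "?n - 4 = Suc (?n - 5)" using n by simp
    then show ?thesis by simp
  qed
  show "card (Sub L) = 2 ^ ?n \<longleftrightarrow> finite_chain L"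
    unfolding finite_chain_iff[OF L]
  proof
    assume "card (Sub L) = 2 ^ ?n"
    then have "card (Sub L) = 32 * 2 ^ (?n - 5)" using p by simp
    then show "incomp_pairs L = {}" using pos by (cases rule: card_Sub_cases[OF n]) auto
  qed (rule card_Sub_no_incomp)
  show "card (Sub L) = 26 * 2 ^ (?n - 5) \<longleftrightarrow>
      (\<exists>(C\<^sub>1 :: nat gorder) (C\<^sub>2 :: nat gorder). finite_chain C\<^sub>1 \<and> finite_chain C\<^sub>2 \<and>
        lattice_iso L (C\<^sub>1 +\<^sub>g\<^sub>l\<^sub>u B4 +\<^sub>g\<^sub>l\<^sub>u C\<^sub>2))"
  proof
    assume c: "card (Sub L) = 26 * 2 ^ (?n - 5)"
    then obtain a b where "incomp_pairs L = {{a, b}}"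
      using pos by (cases rule: card_Sub_cases[OF n]) auto
    then show "\<exists>(C\<^sub>1 :: nat gorder) (C\<^sub>2 :: nat gorder). finite_chain C\<^sub>1 \<and> finite_chain C\<^sub>2 \<and>
        lattice_iso L (C\<^sub>1 +\<^sub>g\<^sub>l\<^sub>u B4 +\<^sub>g\<^sub>l\<^sub>u C\<^sub>2)"
      using incomp_pairs_B4_iso by metis
  next
    assume "\<exists>(C\<^sub>1 :: nat gorder) (C\<^sub>2 :: nat gorder). finite_chain C\<^sub>1 \<and> finite_chain C\<^sub>2 \<and>
        lattice_iso L (C\<^sub>1 +\<^sub>g\<^sub>l\<^sub>u B4 +\<^sub>g\<^sub>l\<^sub>u C\<^sub>2)"
    then obtain C\<^sub>1 C\<^sub>2 :: "nat gorder" where C: "finite_chain C\<^sub>1" "finite_chain C\<^sub>2"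
      and iso: "lattice_iso L (C\<^sub>1 +\<^sub>g\<^sub>l\<^sub>u B4 +\<^sub>g\<^sub>l\<^sub>u C\<^sub>2)" by blast
    \<comment> \<open>That the glued sum is a lattice is taken from the isomorphism, whose
      preservation conditions include it.\<close>
    note M = lattice_iso_finite_lattice[OF L iso]
    interpret M: fin_lattice "C\<^sub>1 +\<^sub>g\<^sub>l\<^sub>u B4 +\<^sub>g\<^sub>l\<^sub>u C\<^sub>2" using M(1) by (simp add: fin_lattice_iff)
    have "incomp_pairs (C\<^sub>1 +\<^sub>g\<^sub>l\<^sub>u B4 +\<^sub>g\<^sub>l\<^sub>u C\<^sub>2) = {{Inl (Inl (Inr B4_a)), Inl (Inl (Inr B4_b))}}"
      using incomp_pairs_glued_chains[OF C B4_props(1-3)] by (simp add: B4_props(4))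
    then show "card (Sub L) = 26 * 2 ^ (?n - 5)"
      using M.card_Sub_one_incomp card_Sub_lattice_iso[OF iso] M(2) n4 by simp
  qed
  show "card (Sub L) = 23 * 2 ^ (?n - 5) \<longleftrightarrow>
      (\<exists>(C\<^sub>0 :: nat gorder) (C\<^sub>1 :: nat gorder). finite_chain C\<^sub>0 \<and> finite_chain C\<^sub>1 \<and>
        lattice_iso L (C\<^sub>0 +\<^sub>g\<^sub>l\<^sub>u N5 +\<^sub>g\<^sub>l\<^sub>u C\<^sub>1))"
  proof
    assume c: "card (Sub L) = 23 * 2 ^ (?n - 5)"
    then obtain a b c where "incomp_pairs L = {{a, b}, {a, c}}" "b \<noteq> c"
      using pos by (cases rule: card_Sub_cases[OF n]) auto
    then show "\<exists>(C\<^sub>0 :: nat gorder) (C\<^sub>1 :: nat gorder). finite_chain C\<^sub>0 \<and> finite_chain C\<^sub>1 \<and>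
        lattice_iso L (C\<^sub>0 +\<^sub>g\<^sub>l\<^sub>u N5 +\<^sub>g\<^sub>l\<^sub>u C\<^sub>1)"
      using incomp_pairs_N5_iso by metis
  next
    assume "\<exists>(C\<^sub>0 :: nat gorder) (C\<^sub>1 :: nat gorder). finite_chain C\<^sub>0 \<and> finite_chain C\<^sub>1 \<and>
        lattice_iso L (C\<^sub>0 +\<^sub>g\<^sub>l\<^sub>u N5 +\<^sub>g\<^sub>l\<^sub>u C\<^sub>1)"
    then obtain C\<^sub>1 C\<^sub>2 :: "nat gorder" where C: "finite_chain C\<^sub>1" "finite_chain C\<^sub>2"
      and iso: "lattice_iso L (C\<^sub>1 +\<^sub>g\<^sub>l\<^sub>u N5 +\<^sub>g\<^sub>l\<^sub>u C\<^sub>2)" by blast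
    note M = lattice_iso_finite_lattice[OF L iso]
    interpret M: fin_lattice "C\<^sub>1 +\<^sub>g\<^sub>l\<^sub>u N5 +\<^sub>g\<^sub>l\<^sub>u C\<^sub>2" using M(1) by (simp add: fin_lattice_iff)
    have "incomp_pairs (C\<^sub>1 +\<^sub>g\<^sub>l\<^sub>u N5 +\<^sub>g\<^sub>l\<^sub>u C\<^sub>2) =
        {{Inl (Inl (Inr N5_b)), Inl (Inl (Inr N5_a))}, {Inl (Inl (Inr N5_b)), Inl (Inl (Inr N5_c))}}"
      using incomp_pairs_glued_chains[OF C N5_props(1-3)] by (simp add: N5_props(4))
    then show "card (Sub L) = 23 * 2 ^ (?n - 5)"
      using M.card_Sub_two_incomp card_Sub_lattice_iso[OF iso] M(2) by simp
  qed
  show "card (Sub L) \<in> {2 ^ ?n, 26 * 2 ^ (?n - 5), 23 * 2 ^ (?n - 5)}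
      \<or> card (Sub L) < 23 * 2 ^ (?n - 5)"
    by (cases rule: card_Sub_cases[OF n]) (simp_all add: p)
qed

subsection \<open>Attaining the values\<close>

text \<open>\<open>R\<close> is the set of pairs \<open>x < y\<close> that are made incomparable.\<close>

definition nat_order_without :: "nat \<Rightarrow> (nat \<times> nat) set \<Rightarrow> nat gorder" where
  "nat_order_without n R =
     \<lparr>carrier = {..<n}, eq = (=), le = (\<lambda>x y. x \<le> y \<and> (x, y) \<notin> R)\<rparr>"

text \<open>Numbers not separated by \<open>R\<close> are comparable and bound each other, so only
  the pairs in \<open>R\<close> need a join and a meet.\<close>

lemma lattice_nat_order_without:
  assumes "partial_order (nat_order_without n R)"
    and R: "\<And>x y. (x, y) \<in> R \<Longrightarrow> x < y \<and> y < n \<and>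
      (\<exists>s. least (nat_order_without n R) s (Upper (nat_order_without n R) {x, y})) \<and>
      (\<exists>s. greatest (nat_order_without n R) s (Lower (nat_order_without n R) {x, y}))"
  shows "lattice (nat_order_without n R)"
proof -
  let ?L = "nat_order_without n R"
  interpret partial_order ?L by (rule assms(1))
  have comp: "least ?L y (Upper ?L {x, y}) \<and> greatest ?L x (Lower ?L {x, y})"
    if "x \<in> carrier ?L" "y \<in> carrier ?L" "x \<sqsubseteq>\<^bsub>?L\<^esub> y" for x y
    using that le_refl by (auto simp: least_def greatest_def Upper_def Lower_def)
  have dir: "x \<sqsubseteq>\<^bsub>?L\<^esub> y \<or> (x, y) \<in> R \<or> y \<sqsubseteq>\<^bsub>?L\<^esub> x \<or> (y, x) \<in> R" for x y
    by (auto simp: nat_order_without_def)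
  show ?thesis
  proof
    fix x y assume c: "x \<in> carrier ?L" "y \<in> carrier ?L"
    show "\<exists>s. least ?L s (Upper ?L {x, y})" "\<exists>s. greatest ?L s (Lower ?L {x, y})"
      using dir[of x y] comp[OF c] comp[OF c(2,1)] R[of x y] R[of y x]
      unfolding insert_commute[of y x] by blast+
  qed
qed

text \<open>The three choices give a chain, a \<open>B4\<close> on \<open>0, 1, 2, 3\<close>, and an
  \<open>N5\<close> on \<open>0, ..., 4\<close> with \<open>1 < 2\<close> against \<open>3\<close>;
  everything above stays a chain. The last choice is where \<open>n\<close> has to reach 5.\<close>

lemma finite_nat_order_without:
  assumes "5 \<le> n" "R \<in> {{}, {(1, 2)}, {(1, 3), (2, 3)}}"
  shows "finite_lattice (nat_order_without n R)" "card (carrier (nat_order_without n R)) = n"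
    "incomp_pairs (nat_order_without n R) = {{x, y} |x y. (x, y) \<in> R}"
proof -
  let ?L = "nat_order_without n R"
  show "card (carrier ?L) = n" by (simp add: nat_order_without_def)
  have po: "partial_order ?L"
  proof
    show "x \<sqsubseteq>\<^bsub>?L\<^esub> z" if "x \<sqsubseteq>\<^bsub>?L\<^esub> y" "y \<sqsubseteq>\<^bsub>?L\<^esub> z" for x y z
    proof -
      have xyz: "x \<le> y" "y \<le> z" "(x, y) \<notin> R" "(y, z) \<notin> R"
        using that by (auto simp: nat_order_without_def)
      \<comment> \<open>For \<open>R = {(1, 3), (2, 3)}\<close>, a detour from \<open>1\<close> to
        \<open>3\<close> through \<open>2\<close> is blocked because \<open>(2, 3)\<close> is
        removed too; for \<open>(1, 2)\<close> no number lies strictly between.\<close>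
      have "(x, z) \<notin> R"
        using assms(2) xyz unfolding insert_iff empty_iff
        by - (elim disjE; simp; presburger)
      then show ?thesis using xyz by (simp add: nat_order_without_def)
    qed
  qed (use assms(2) in \<open>auto simp: nat_order_without_def\<close>)
  have R: "0 < x \<and> x < y \<and> y < n \<and> Suc y < n" if "(x, y) \<in> R" for x y
    using that assms by auto
  \<comment> \<open>For a removed pair \<open>x < y\<close>, the number after \<open>y\<close> is
    the first above both, and everything from \<open>1\<close> up to \<open>x\<close> has lost its
    relation to \<open>y\<close>, which leaves \<open>0\<close> as the meet.\<close>
  have "least ?L (Suc y) (Upper ?L {x, y}) \<and> greatest ?L 0 (Lower ?L {x, y})"
    if xy: "(x, y) \<in> R" for x y
  proof -
    note n = R[OF xy]
    have up: "Upper ?L {x, y} = {z. z < n \<and> x \<le> z \<and> (x, z) \<notin> R \<and> y \<le> z \<and> (y, z) \<notin> R}"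
      using n by (auto simp: nat_order_without_def Upper_def)
    have low: "Lower ?L {x, y} = {z. z < n \<and> z \<le> x \<and> (z, x) \<notin> R \<and> z \<le> y \<and> (z, y) \<notin> R}"
      using n by (auto simp: nat_order_without_def Lower_def)
    have s: "(x, Suc y) \<notin> R" "(y, Suc y) \<notin> R" "(Suc y, z) \<notin> R" "(0, z) \<notin> R" for z
      using assms(2) xy by auto
    have "Suc y \<le> z" if "y \<le> z" "(x, z) \<notin> R" for z
      using that xy by (metis le_antisym not_less_eq_eq)
    moreover have "z = 0" if "z \<le> x" "(z, y) \<notin> R" for z
      using assms(2) xy that unfolding insert_iff empty_iff by - (elim disjE, simp_all, linarith+)
    ultimately show ?thesis
      unfolding least_def greatest_def up low using n s by (auto simp: nat_order_without_def)
  qed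
  then have "lattice ?L" by (intro lattice_nat_order_without[OF po]) (use R in blast)
  then show "finite_lattice ?L"
    using assms(1) by (auto simp: finite_lattice_def nat_order_without_def lessThan_empty_iff)
  have "incomp ?L x y \<longleftrightarrow> (x, y) \<in> R \<or> (y, x) \<in> R" for x y
    using R[of x y] R[of y x] by (auto simp: incomp_def nat_order_without_def)
  then show "incomp_pairs ?L = {{x, y} |x y. (x, y) \<in> R}"
    unfolding incomp_pairs_def by (auto simp: insert_commute)
qed

text \<open>The count depends only on the incomparable pairs, so the example orders need not be
  identified with glued sums.\<close>

lemma NS_elements:
  assumes n: "5 \<le> n"
  shows "2 ^ n \<in> NS n" "26 * 2 ^ (n - 5) \<in> NS n" "23 * 2 ^ (n - 5) \<in> NS n"
proof -
  note L = finite_nat_order_without[OF n]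
  have mem: "card (Sub (nat_order_without n R)) \<in> NS n" "fin_lattice (nat_order_without n R)"
    if "R \<in> {{}, {(1, 2)}, {(1, 3), (2, 3)}}" for R
    using card_Sub_in_NS[OF L(1)[OF that]] L(1,2)[OF that] by (simp_all add: fin_lattice_iff)
  show "2 ^ n \<in> NS n"
    using mem[of "{}"] L(2,3)[of "{}"] fin_lattice.card_Sub_no_incomp[of "nat_order_without n {}"]
    by simp
  have "n - 4 = Suc (n - 5)" using n by simp
  moreover have "incomp_pairs (nat_order_without n {(1, 2)}) = {{1, 2}}"
    using L(3)[of "{(1, 2)}"] by simp
  ultimately show "26 * 2 ^ (n - 5) \<in> NS n"
    using mem[of "{(1, 2)}"] L(2)[of "{(1, 2)}"]
      fin_lattice.card_Sub_one_incomp[of "nat_order_without n {(1, 2)}" 1 2]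
    by simp
  have "incomp_pairs (nat_order_without n {(1, 3), (2, 3)}) = {{3, 1}, {3, 2}}"
    using L(3)[of "{(1, 3), (2, 3)}"] by auto
  then show "23 * 2 ^ (n - 5) \<in> NS n"
    using mem[of "{(1, 3), (2, 3)}"] L(2)[of "{(1, 3), (2, 3)}"]
      fin_lattice.card_Sub_two_incomp[of "nat_order_without n {(1, 3), (2, 3)}" 3 1 2]
    by simp
qed

section \<open>Ranking the values\<close>

lemma NS_cases:
  assumes "5 \<le> n" "y \<in> NS n"
  shows "y \<in> {2 ^ n, 26 * 2 ^ (n - 5), 23 * 2 ^ (n - 5)} \<or> y < 23 * 2 ^ (n - 5)"
  using assms card_Sub_iff(4) unfolding NS_def by blast

theorem theorem1p1:
  fixes n :: nat
  assumes "n \<ge> 5"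
  shows
    "(kth_largest 1 (NS n) (2 ^ n) \<and> (2::nat) ^ n = 32 * 2 ^ (n - 5) \<and>
      (\<forall>L :: 'a gorder. finite_lattice L \<and> card (carrier L) = n \<longrightarrow>
         (card (Sub L) = 2 ^ n \<longleftrightarrow> finite_chain L))) \<and>
     (kth_largest 2 (NS n) (26 * 2 ^ (n - 5)) \<and>
      (\<forall>L :: 'a gorder. finite_lattice L \<and> card (carrier L) = n \<longrightarrow>
         (card (Sub L) = 26 * 2 ^ (n - 5) \<longleftrightarrow>
          (\<exists>(C\<^sub>1 :: nat gorder) (C\<^sub>2 :: nat gorder). finite_chain C\<^sub>1 \<and> finite_chain C\<^sub>2 \<and>
             lattice_iso L (C\<^sub>1 +\<^sub>g\<^sub>l\<^sub>u B4 +\<^sub>g\<^sub>l\<^sub>u C\<^sub>2))))) \<and>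
     (kth_largest 3 (NS n) (23 * 2 ^ (n - 5)) \<and>
      (\<forall>L :: 'a gorder. finite_lattice L \<and> card (carrier L) = n \<longrightarrow>
         (card (Sub L) = 23 * 2 ^ (n - 5) \<longleftrightarrow>
          (\<exists>(C\<^sub>0 :: nat gorder) (C\<^sub>1 :: nat gorder). finite_chain C\<^sub>0 \<and> finite_chain C\<^sub>1 \<and>
             lattice_iso L (C\<^sub>0 +\<^sub>g\<^sub>l\<^sub>u N5 +\<^sub>g\<^sub>l\<^sub>u C\<^sub>1)))))"
proof -
  have p: "(2::nat) ^ n = 32 * 2 ^ (n - 5)"
    using power_add[of "2::nat" 5 "n - 5"] assms by simp
  have pos: "0 < (2::nat) ^ (n - 5)" by simp
  note mem = NS_elements[OF assms]
  \<comment> \<open>\<open>kth_largest k\<close> asks for exactly \<open>k - 1\<close> strictly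
    larger values, so these sets must have 0, 1 and 2 elements.\<close>
  have a1: "{y \<in> NS n. 2 ^ n < y} = {}"
    using NS_cases[OF assms] p pos by fastforce
  have a2: "{y \<in> NS n. 26 * 2 ^ (n - 5) < y} = {2 ^ n}"
    using NS_cases[OF assms] p pos mem by fastforce
  have a3: "{y \<in> NS n. 23 * 2 ^ (n - 5) < y} = {2 ^ n, 26 * 2 ^ (n - 5)}"
    using NS_cases[OF assms] p pos mem by fastforce
  have "(2::nat) ^ n \<noteq> 26 * 2 ^ (n - 5)" using p pos by simp
  then have "kth_largest 1 (NS n) (2 ^ n)" "kth_largest 2 (NS n) (26 * 2 ^ (n - 5))"
    "kth_largest 3 (NS n) (23 * 2 ^ (n - 5))"
    using mem by (simp_all add: kth_largest_def a1 a2 a3)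
  \<comment> \<open>\<open>card_Sub_iff\<close> is polymorphic: the ranking used it on
    \<open>nat\<close>, and here it is applied to lattices over \<open>'a\<close>.\<close>
  then show ?thesis
    using p assms
    by - (intro conjI allI impI; (elim conjE, hypsubst)?; (assumption | (rule card_Sub_iff; assumption)))
qed

end
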